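(* Let $d,n,t\in\mathbb{N}$ and let $Y\subseteq\mathbb{T}^d$ be an order $2$ digital $(t,n,d)$-net (in base $2$) of cardinality $N=2^n$. Let $X=\mathcal{R}Y=\{(|2y_1-1|,\dots,|2y_d-1|):(y_1,\dots,y_d)\in Y\}\subseteq[0,1]^d$ be the tent transformed point (multi)set, with $\#X=N$ counted with multiplicity. Then $$ e^{\mathrm{QMC}}(X,H^2_{\mathrm{mix}}([0,1]^d))\le C\,2^t N^{-2}(\log N)^{2d-1}, $$ where $C>0$ depends only on $d$.
   Context: $\mathbb{T}^d$ is identified with $[0,1)^d$. $H^2_{\mathrm{mix}}([0,1]^d)$ is the $d$-fold Hilbert tensor product of $H^2([0,1])=\{f\in L_2([0,1]):f''\in L_2([0,1])\}$ (weak derivative) with norm $\|f\|^2=\|f\|^2_{L_2}+\|f''\|^2_{L_2}$; equivalently the real functions $f$ on $[0,1]^d$ with $\big(\prod_{i\in e}\partial^2/\partial x_i^2\big)f\in L_2([0,1]^d)$ for all $e\subseteq\{1,\dots,d\}$, normed by the square root of the sum of the squared $L_2$-norms of these derivatives (any equivalent norm changes only the constant). For a finite multiset $X\subseteq[0,1]^d$ of $N$ points, $e^{\mathrm{QMC}}(X,H^2_{\mathrm{mix}}([0,1]^d))=\sup_{\|f\|\le1}\big|\frac1N\sum_{\mathbf{x}\in X}f(\mathbf{x})-\int_{[0,1]^d}f(\mathbf{x})\,d\mathbf{x}\big|$. Order $\alpha$ digital nets: let $C_1,\dots,C_d\in\{0,1\}^{\alpha n\times n}$ be matrices over the field $\mathbb{Z}/2\mathbb{Z}$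 with rows $c_{i,1}^\top,\dots,c_{i,\alpha n}^\top$. For $k=\kappa_0+2\kappa_1+\dots+2^{n-1}\kappa_{n-1}\in\{0,\dots,2^n-1\}$ with $\kappa=(\kappa_0,\dots,\kappa_{n-1})^\top$, compute $C_i\kappa=(\kappa^{(i)}_1,\dots,\kappa^{(i)}_{\alpha n})^\top$ over $\mathbb{Z}/2\mathbb{Z}$ and set $y^k_i=\sum_{\ell=1}^{\alpha n}\kappa^{(i)}_\ell 2^{-\ell}$; the digital net is $Y=\{\mathbf{y}^0,\dots,\mathbf{y}^{2^n-1}\}$. It is an order $\alpha$ digital $(t,n,d)$-net if for all choices of integers $0\le\nu_i\le n$ and indices $1\le j_{i,\nu_i}<\dots<j_{i,1}\le\alpha n$ ($i=1,\dots,d$) with $\sum_{i=1}^d\sum_{\ell=1}^{\min\{\alpha,\nu_i\}}j_{i,\ell}\le\alpha n-t$, the row vectors $c_{1,j_{1,\nu_1}},\dots,c_{1,j_{1,1}},\dots,c_{d,j_{d,\nu_d}},\dots,c_{d,j_{d,1}}\in\{0,1\}^n$ are linearly independent over $\mathbb{Z}/2\mathbb{Z}$. Here $\alpha=2$. *)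

theory Defs
  imports "HOL-Analysis.Analysis" "HOL-Library.Multiset"
begin

definition unit_cube :: "(real^'d) set" where
  "unit_cube = cbox 0 1"

definition pd :: "'d::finite \<Rightarrow> (real^'d \<Rightarrow> real) \<Rightarrow> real^'d \<Rightarrow> real" where
  "pd i g x = deriv (\<lambda>s. g (x + s *\<^sub>R axis i 1)) 0"

fun iter_pd :: "'d::finite list \<Rightarrow> (real^'d \<Rightarrow> real) \<Rightarrow> real^'d \<Rightarrow> real" where
  "iter_pd [] g = g"
| "iter_pd (i # is) g = pd i (iter_pd is g)"

definition test_fn :: "(real^'d::finite \<Rightarrow> real) \<Rightarrow> bool" where
  "test_fn \<phi> \<longleftrightarrow>
     (\<forall>is. continuous_on UNIV (iter_pd is \<phi>) \<and>
           (\<forall>i x. (\<lambda>s. iter_pd is \<phi> (x + s *\<^sub>R axis i 1)) field_differentiable (at 0))) \<and>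
     (\<exists>K. compact K \<and> K \<subseteq> box 0 1 \<and> (\<forall>x. x \<notin> K \<longrightarrow> \<phi> x = 0))"

definition in_L2 :: "(real^'d::finite \<Rightarrow> real) \<Rightarrow> bool" where
  "in_L2 g \<longleftrightarrow> g \<in> borel_measurable (lebesgue_on unit_cube) \<and>
                integrable (lebesgue_on unit_cube) (\<lambda>x. (g x)^2)"

text \<open>g is the weak derivative (\<Prod>_{i\<in>e} \<partial>^2/\<partial>x_i^2) f on (0,1)^d
  (the sign (-1)^(2|e|) is 1). Any ordering of the differentiations is allowed.\<close>
definition is_weak_mixed2 :: "'d::finite set \<Rightarrow> (real^'d \<Rightarrow> real) \<Rightarrow> (real^'d \<Rightarrow> real) \<Rightarrow> bool" where
  "is_weak_mixed2 e f g \<longleftrightarrow>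
     (\<forall>\<phi>. test_fn \<phi> \<longrightarrow>
        (\<forall>is. (\<forall>i. count (mset is) i = (if i \<in> e then 2 else 0)) \<longrightarrow>
           (LINT x|lebesgue_on unit_cube. f x * iter_pd is \<phi> x) =
           (LINT x|lebesgue_on unit_cube. g x * \<phi> x)))"

definition H2mix :: "(real^'d::finite \<Rightarrow> real) set" where
  "H2mix = {f. \<forall>e. \<exists>g. in_L2 g \<and> is_weak_mixed2 e f g}"

definition weak_D :: "'d::finite set \<Rightarrow> (real^'d \<Rightarrow> real) \<Rightarrow> (real^'d \<Rightarrow> real)" where
  "weak_D e f = (SOME g. in_L2 g \<and> is_weak_mixed2 e f g)"

definition H2mix_norm :: "(real^'d::finite \<Rightarrow> real) \<Rightarrow> real" where
  "H2mix_norm f = sqrt (\<Sum>e\<in>(UNIV :: 'd set set). LINT x|lebesgue_on unit_cube. (weak_D e f x)^2)"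

text \<open>Point evaluation is taken for the continuous representative on [0,1]^d.\<close>
definition qmc_wce :: "(real^'d::finite) multiset \<Rightarrow> ereal" where
  "qmc_wce X = (SUP f \<in> {f. f \<in> H2mix \<and> continuous_on unit_cube f \<and> H2mix_norm f \<le> 1}.
      ereal \<bar>(\<Sum>x\<in>#X. f x) / real (size X) - (LINT x|lebesgue_on unit_cube. f x)\<bar>)"

text \<open>Generating matrices: Cm i l r is the entry of C_i in row l (1-based, 1..alpha*n)
  and column r (0-based, 0..n-1, multiplying kappa_r).\<close>

definition digit :: "nat \<Rightarrow> ('d \<Rightarrow> nat \<Rightarrow> nat \<Rightarrow> bool) \<Rightarrow> 'd \<Rightarrow> nat \<Rightarrow> nat \<Rightarrow> bool" where
  "digit n Cm i l k = odd (card {r. r < n \<and> Cm i l r \<and> odd (k div 2 ^ r)})"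

definition net_point :: "nat \<Rightarrow> nat \<Rightarrow> ('d::finite \<Rightarrow> nat \<Rightarrow> nat \<Rightarrow> bool) \<Rightarrow> nat \<Rightarrow> real^'d" where
  "net_point \<alpha> n Cm k = (\<chi> i. \<Sum>l=1..\<alpha>*n. (if digit n Cm i l k then 1 else 0) * (1/2) ^ l)"

definition digital_net :: "nat \<Rightarrow> nat \<Rightarrow> ('d::finite \<Rightarrow> nat \<Rightarrow> nat \<Rightarrow> bool) \<Rightarrow> (real^'d) multiset" where
  "digital_net \<alpha> n Cm = image_mset (net_point \<alpha> n Cm) (mset_set {..<2^n})"

definition top_sum :: "nat \<Rightarrow> nat set \<Rightarrow> nat" where
  "top_sum \<alpha> J = (\<Sum>j\<in>{j\<in>J. card {k\<in>J. j < k} < \<alpha>}. j)"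

definition rows_independent :: "nat \<Rightarrow> ('d \<Rightarrow> nat \<Rightarrow> nat \<Rightarrow> bool) \<Rightarrow> ('d \<times> nat) set \<Rightarrow> bool" where
  "rows_independent n Cm S \<longleftrightarrow>
     (\<forall>T. T \<subseteq> S \<and> T \<noteq> {} \<longrightarrow> (\<exists>r<n. odd (card {p\<in>T. Cm (fst p) (snd p) r})))"

definition is_order_digital_net :: "nat \<Rightarrow> nat \<Rightarrow> nat \<Rightarrow> ('d::finite \<Rightarrow> nat \<Rightarrow> nat \<Rightarrow> bool) \<Rightarrow> bool" where
  "is_order_digital_net \<alpha> t n Cm \<longleftrightarrow>
     (\<forall>J :: 'd \<Rightarrow> nat set.
        (\<forall>i. J i \<subseteq> {1..\<alpha>*n} \<and> card (J i) \<le> n) \<longrightarrow>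
        int (\<Sum>i\<in>UNIV. top_sum \<alpha> (J i)) \<le> int (\<alpha>*n) - int t \<longrightarrow>
        rows_independent n Cm (SIGMA i:UNIV. J i))"

definition tent :: "real^'d \<Rightarrow> real^'d" where
  "tent y = (\<chi> i. \<bar>2 * y$i - 1\<bar>)"

end

theory Submission
  imports Defs "HOL-Real_Asymp.Real_Asymp"
begin

text \<open>
  Smooth test functions of product form give, for a mollification of \<open>f\<close>, a representation
  \<open>f(x) = \<Sum>\<^sub>e \<integral> g\<^sub>e(s) \<Prod>\<^sub>i K\<^sub>e\<^sub>,\<^sub>i(x\<^sub>i, s\<^sub>i) ds\<close> by the weak derivatives \<open>g\<^sub>e\<close>, in which every kernel is
  convex in \<open>x\<^sub>i\<close> with uniformly bounded value and slope. So it suffices to bound the error for products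
  of such univariate functions. On the grid of dyadic midpoints of level \<open>L\<close>, finite Walsh inversion
  expresses the difference of the net average and the grid average as the sum of the Walsh coefficients
  over the nonzero elements of the dual net. A univariate coefficient of a convex function composed with
  the tent map is \<open>O(2\<^bsup>-a-b\<^esup>)\<close>, where \<open>a > b\<close> are the two leading digit positions; summing over the dual
  net, whose elements differ from each other and from 0 by weight larger than \<open>2n - t\<close>, gives the rate.
  Letting the mollification parameter tend to 0 and then \<open>L\<close> to infinity yields the integration error of \<open>f\<close>.
\<close>

section \<open>The two largest elements of a finite set\<close>

definition top1 :: "nat set \<Rightarrow> nat" where
  "top1 J = Max (insert 0 J)"

definition top2 :: "nat set \<Rightarrow> nat" where
  "top2 J = top1 (J - {top1 J})"

lemma le_top1: "finite J \<Longrightarrow> j \<in> J \<Longrightarrow> j \<le> top1 J"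
  by (simp add: top1_def)

lemma le_top2: "finite J \<Longrightarrow> j \<in> J \<Longrightarrow> j \<noteq> top1 J \<Longrightarrow> j \<le> top2 J"
  by (simp add: top2_def le_top1)

lemma top1_in:
  assumes "finite J" "J \<noteq> {}"
  shows "top1 J \<in> J"
  using assms Max_in[of J] by (simp add: top1_def max_def)

lemma top1_le: "finite J \<Longrightarrow> J \<subseteq> {..c} \<Longrightarrow> top1 J \<le> c"
  by (auto simp: top1_def)

lemma top2_le: "finite J \<Longrightarrow> J \<subseteq> {..c} \<Longrightarrow> top2 J \<le> c"
  unfolding top2_def by (intro top1_le) auto

lemma top2_le_top1: "finite J \<Longrightarrow> top2 J \<le> top1 J"
  by (rule top2_le) (auto simp: le_top1)

lemma top2_less_top1:
  assumes "finite J" "top1 J > 0"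
  shows "top2 J < top1 J"
  using assms le_top1[OF assms(1)]
  by (auto simp: top2_def top1_def[of "J - _"] order.not_eq_order_implies_strict)

lemma mem_iff_top:
  assumes "finite J" "0 \<notin> J"
  shows "c \<in> J \<longleftrightarrow> c \<in> J \<inter> {..top2 J} \<or> c = top1 J \<and> c \<noteq> 0"
proof (cases "J = {}")
  case True
  then show ?thesis by (auto simp: top1_def)
next
  case False
  then show ?thesis using le_top2[of J c] top1_in[of J] assms by auto
qed

lemma top1_image_Suc:
  assumes "finite J" "J \<noteq> {}"
  shows "top1 (Suc ` J) = Suc (top1 J)"
proof -
  have "Max (Suc ` J) = Suc (Max J)"
    using assms by (intro mono_Max_commute[symmetric]) (auto simp: mono_def)
  then show ?thesis using assms by (simp add: top1_def)
qed

lemma top2_image_Suc: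
  assumes "finite J" "J \<noteq> {}"
  shows "top2 (Suc ` J) = top1 (Suc ` (J - {top1 J}))"
proof -
  have "Suc ` J - {Suc (top1 J)} = Suc ` (J - {top1 J})" by auto
  then show ?thesis by (simp add: top2_def top1_image_Suc[OF assms])
qed

lemma top_sum_0 [simp]: "top_sum 0 J = 0"
  by (simp add: top_sum_def)

lemma top_sum_Suc:
  assumes J: "finite J"
  shows "top_sum (Suc \<alpha>) J = top1 J + top_sum \<alpha> (J - {top1 J})"
proof (cases "J = {}")
  case True
  then show ?thesis by (simp add: top_sum_def top1_def)
next
  case False
  define a where "a = top1 J"
  have a: "a \<in> J" unfolding a_def by (rule top1_in[OF J False])
  have "{k \<in> J. a < k} = {}" using le_top1[OF J] by (auto simp: a_def not_less)
  then have above_a: "card {k \<in> J. a < k} = 0" by (simp only: card.empty)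
  have above: "card {k \<in> J. j < k} = Suc (card {k \<in> J - {a}. j < k})" if "j \<in> J - {a}" for j
  proof -
    have "j < a" using le_top1[OF J, of j] that by (auto simp: a_def)
    then have "{k \<in> J. j < k} = insert a {k \<in> J - {a}. j < k}" using a by auto
    then show ?thesis using J by simp
  qed
  have "{j \<in> J. card {k \<in> J. j < k} < Suc \<alpha>} = insert a {j \<in> J - {a}. card {k \<in> J - {a}. j < k} < \<alpha>}"
  proof (rule set_eqI)
    fix j
    show "j \<in> {j \<in> J. card {k \<in> J. j < k} < Suc \<alpha>}
      \<longleftrightarrow> j \<in> insert a {j \<in> J - {a}. card {k \<in> J - {a}. j < k} < \<alpha>}"
      using a above_a above[of j] by (cases "j = a") auto
  qed
  then show ?thesis using J by (simp add: top_sum_def a_def)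
qed

lemma top_sum_2: "finite J \<Longrightarrow> top_sum 2 J = top1 J + top2 J"
  by (simp add: numeral_2_eq_2 top_sum_Suc top2_def)

lemma le_top_sum_2: "finite J \<Longrightarrow> j \<in> J \<Longrightarrow> j \<le> top_sum 2 J"
  using le_top1[of J j] by (simp add: top_sum_2)

lemma card_le_half_top_sum_2:
  assumes "finite J" "0 \<notin> J" "top_sum 2 J \<le> 2 * n"
  shows "card J \<le> n"
proof (cases "J = {}")
  case False
  then have pos: "top1 J > 0" using top1_in[of J] assms(1,2) by (metis gr0I)
  have "J \<subseteq> insert (top1 J) {1..top2 J}"
  proof
    fix j assume "j \<in> J"
    then show "j \<in> insert (top1 J) {1..top2 J}"
      using assms(2) le_top2[OF assms(1), of j] by (cases j) auto
  qed
  then have "card J \<le> card (insert (top1 J) {1..top2 J})" by (intro card_mono) auto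
  also have "\<dots> \<le> Suc (top2 J)" by (simp add: card_insert_if)
  finally show ?thesis using top2_less_top1[OF assms(1) pos] assms by (simp add: top_sum_2)
qed simp

lemma top_sum_2_image_Suc_le:
  assumes "finite J"
  shows "top_sum 2 (Suc ` J) \<le> top_sum 2 (J - {0}) + 2"
proof (cases "J = {}")
  case False
  have drop0: "top1 (I - {0}) = top1 I" for I by (simp add: top1_def)
  have top1_Suc_le: "top1 (Suc ` I) \<le> Suc (top1 I)" if "finite I" for I
    using that by (intro top1_le) (auto simp: le_top1)
  have "top2 (J - {0}) = top1 (J - {top1 J})"
    using drop0[of "J - {top1 J}"] by (simp add: top2_def drop0 Diff_insert2[symmetric] insert_commute)
  then show ?thesis
    using assms False top1_Suc_le[of J] top1_Suc_le[of "J - {top1 J}"]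
    by (simp add: top_sum_2 drop0 top2_image_Suc)
qed (simp add: top_sum_def)

section \<open>Walsh coefficients of univariate functions\<close>

definition walsh :: "'a set \<Rightarrow> 'a set \<Rightarrow> real" where
  "walsh T A = (-1) ^ card (A \<inter> T)"

text \<open>The binary digit of \<open>dyadic_mid L A\<close> at position \<open>l + 1\<close> is 1 iff \<open>l \<in> A\<close>, for \<open>l < L\<close>: digit
  positions are 0-based from here on, whereas the rows of the generating matrices are 1-based.\<close>

definition dyadic_mid :: "nat \<Rightarrow> nat set \<Rightarrow> real" where
  "dyadic_mid L A = (\<Sum>l\<in>A. (1/2) ^ Suc l) + (1/2) ^ Suc L"

definition walsh_coeff :: "nat \<Rightarrow> nat set \<Rightarrow> (real \<Rightarrow> real) \<Rightarrow> real" where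
  "walsh_coeff L J h = (\<Sum>A\<in>Pow {..<L}. walsh J A * h (dyadic_mid L A)) / 2 ^ L"

definition lower_half :: "(real \<Rightarrow> 'a) \<Rightarrow> real \<Rightarrow> 'a" where
  "lower_half h x = h (x / 2)"

definition upper_half :: "(real \<Rightarrow> 'a) \<Rightarrow> real \<Rightarrow> 'a" where
  "upper_half h x = h ((x + 1) / 2)"

lemma finite_of_Pow_lessThan: "A \<in> Pow {..<L::nat} \<Longrightarrow> finite A"
  using finite_subset by auto

lemma Suc_image_vimage_Suc: "Suc ` (Suc -` J) = J - {0}"
  by (auto simp: image_iff gr0_conv_Suc)

lemma walsh_commute: "walsh T A = walsh A T"
  by (simp add: walsh_def Int_commute)

lemma abs_walsh [simp]: "\<bar>walsh T A\<bar> = 1"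
  by (simp add: walsh_def)

lemma walsh_eq_prod:
  assumes "finite T"
  shows "walsh T A = (\<Prod>l\<in>T. if l \<in> A then -1 else 1)"
  using prod.inter_restrict[OF assms, of "\<lambda>_. -1::real" A] by (simp add: walsh_def Int_commute)

lemma walsh_image_Suc: "walsh J (Suc ` B) = walsh (Suc -` J) B"
proof -
  have "Suc ` B \<inter> J = Suc ` (B \<inter> Suc -` J)" by auto
  then show ?thesis by (simp add: walsh_def card_image)
qed

lemma walsh_insert_0:
  assumes "finite B"
  shows "walsh J (insert 0 (Suc ` B)) = (if 0 \<in> J then -1 else 1) * walsh (Suc -` J) B"
proof -
  have "walsh J (insert 0 (Suc ` B)) = (if 0 \<in> J then -1 else 1) * walsh J (Suc ` B)"
    using assms unfolding walsh_commute[of J] by (simp add: walsh_eq_prod)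
  then show ?thesis by (simp add: walsh_image_Suc)
qed

lemma dyadic_mid_image_Suc: "dyadic_mid (Suc L) (Suc ` B) = dyadic_mid L B / 2"
  by (simp add: dyadic_mid_def sum.reindex sum_divide_distrib add_divide_distrib)

lemma dyadic_mid_insert_0:
  assumes "finite B"
  shows "dyadic_mid (Suc L) (insert 0 (Suc ` B)) = (dyadic_mid L B + 1) / 2"
proof -
  have "0 \<notin> Suc ` B" by auto
  then have "dyadic_mid (Suc L) (insert 0 (Suc ` B)) = 1/2 + dyadic_mid (Suc L) (Suc ` B)"
    using assms by (simp add: dyadic_mid_def)
  then show ?thesis by (simp add: dyadic_mid_image_Suc add_divide_distrib)
qed

lemma dyadic_mid_in_unit_interval:
  assumes "A \<subseteq> {..<L}"
  shows "dyadic_mid L A \<in> {0<..<1}"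
proof -
  have "(\<Sum>l\<in>A. (1/2::real) ^ Suc l) \<le> (\<Sum>l<L. (1/2) ^ Suc l)"
    using assms by (intro sum_mono2) auto
  also have "\<dots> = 1 - (1/2) ^ L"
    by (induction L) (auto simp: field_simps)
  finally have "dyadic_mid L A \<le> 1 - (1/2) ^ Suc L" by (simp add: dyadic_mid_def)
  moreover have "(0::real) < (1/2) ^ Suc L" by simp
  ultimately have "dyadic_mid L A < 1" by linarith
  moreover have "dyadic_mid L A > 0" by (simp add: dyadic_mid_def sum_nonneg add_nonneg_pos)
  ultimately show ?thesis by simp
qed

lemma sum_Pow_lessThan_Suc:
  fixes F :: "nat set \<Rightarrow> 'a::comm_monoid_add"
  shows "(\<Sum>A\<in>Pow {..<Suc L}. F A) = (\<Sum>B\<in>Pow {..<L}. F (Suc ` B) + F (insert 0 (Suc ` B)))"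
proof -
  have Pow_Suc: "Pow {..<Suc L} = (`) Suc ` Pow {..<L} \<union> (\<lambda>B. insert 0 (Suc ` B)) ` Pow {..<L}"
    unfolding lessThan_Suc_eq_insert_0 Pow_insert image_Pow_surj[OF refl, symmetric] image_image ..
  have disj: "(`) Suc ` Pow {..<L} \<inter> (\<lambda>B. insert 0 (Suc ` B)) ` Pow {..<L} = {}"
    by auto
  have inj_Suc: "inj_on ((`) Suc) (Pow {..<L})"
    by (auto intro!: inj_onI simp: inj_image_eq_iff)
  have inj_insert: "inj_on (\<lambda>B. insert 0 (Suc ` B)) (Pow {..<L})"
  proof (rule inj_onI)
    fix B B' :: "nat set" assume "insert 0 (Suc ` B) = insert 0 (Suc ` B')"
    then have "Suc ` B = Suc ` B'" by (metis Diff_insert_absorb image_iff nat.distinct(1))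
    then show "B = B'" by (simp add: inj_image_eq_iff)
  qed
  show ?thesis
    unfolding Pow_Suc
    by (subst sum.union_disjoint[OF _ _ disj]) (simp_all add: sum.reindex inj_Suc inj_insert sum.distrib)
qed

lemma walsh_coeff_Suc:
  "walsh_coeff (Suc L) J h =
     (walsh_coeff L (Suc -` J) (lower_half h)
      + (if 0 \<in> J then -1 else 1) * walsh_coeff L (Suc -` J) (upper_half h)) / 2"
proof -
  have "(\<Sum>A\<in>Pow {..<Suc L}. walsh J A * h (dyadic_mid (Suc L) A))
      = (\<Sum>B\<in>Pow {..<L}. walsh (Suc -` J) B * lower_half h (dyadic_mid L B)
          + (if 0 \<in> J then -1 else 1) * (walsh (Suc -` J) B * upper_half h (dyadic_mid L B)))"
    unfolding sum_Pow_lessThan_Suc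
    by (rule sum.cong) (simp_all only: finite_of_Pow_lessThan walsh_image_Suc walsh_insert_0
        dyadic_mid_image_Suc dyadic_mid_insert_0 lower_half_def upper_half_def mult.assoc)
  then show ?thesis
    unfolding walsh_coeff_def by (simp add: sum.distrib sum_distrib_left field_simps flip: sum_negf)
qed

lemma abs_walsh_coeff_Suc_le:
  "\<bar>walsh_coeff (Suc L) J h\<bar> \<le>
     (\<bar>walsh_coeff L (Suc -` J) (lower_half h)\<bar> + \<bar>walsh_coeff L (Suc -` J) (upper_half h)\<bar>) / 2"
  unfolding walsh_coeff_Suc by auto

lemma walsh_coeff_diff:
  "walsh_coeff L J (\<lambda>x. f x - g x) = walsh_coeff L J f - walsh_coeff L J g"
  by (simp add: walsh_coeff_def algebra_simps sum_subtractf diff_divide_distrib)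

lemma walsh_coeff_Suc_of_0_mem:
  "0 \<in> J \<Longrightarrow> walsh_coeff (Suc L) J h = walsh_coeff L (Suc -` J) (\<lambda>x. lower_half h x - upper_half h x) / 2"
  by (simp add: walsh_coeff_Suc walsh_coeff_diff)

lemma walsh_coeff_cong:
  assumes "\<And>x. x \<in> {0..1} \<Longrightarrow> f x = g x"
  shows "walsh_coeff L J f = walsh_coeff L J g"
proof -
  have "f (dyadic_mid L A) = g (dyadic_mid L A)" if "A \<subseteq> {..<L}" for A
    using dyadic_mid_in_unit_interval[OF that] by (intro assms) simp
  then show ?thesis by (simp add: walsh_coeff_def)
qed

lemma abs_walsh_coeff_le:
  assumes "\<And>x. x \<in> {0..1} \<Longrightarrow> \<bar>h x\<bar> \<le> M"
  shows "\<bar>walsh_coeff L J h\<bar> \<le> M"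
proof -
  have bound: "\<bar>h (dyadic_mid L A)\<bar> \<le> M" if "A \<subseteq> {..<L}" for A
    using dyadic_mid_in_unit_interval[OF that] by (intro assms) simp
  have "\<bar>\<Sum>A\<in>Pow {..<L}. walsh J A * h (dyadic_mid L A)\<bar> \<le> (\<Sum>A\<in>Pow {..<L}. \<bar>walsh J A * h (dyadic_mid L A)\<bar>)"
    by (rule sum_abs)
  also have "\<dots> \<le> (\<Sum>A\<in>Pow {..<L}. M)"
    using bound by (intro sum_mono) (simp add: abs_mult)
  finally show ?thesis by (simp add: walsh_coeff_def card_Pow field_simps)
qed

lemma lipschitz_on_half:
  assumes "K-lipschitz_on {0..1} h"
  shows "(K/2)-lipschitz_on {0..1} (lower_half h)" "(K/2)-lipschitz_on {0..1} (upper_half h)"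
proof -
  have "0 \<le> K" using assms by (rule lipschitz_on_nonneg)
  moreover have "dist (h u) (h v) \<le> K * dist u v" if "u \<in> {0..1}" "v \<in> {0..1}" for u v
    using lipschitz_onD[OF assms that] .
  from this[of "_ / 2" "_ / 2"] this[of "(_ + 1) / 2" "(_ + 1) / 2"]
  have "dist (lower_half h x) (lower_half h y) \<le> K/2 * dist x y"
    "dist (upper_half h x) (upper_half h y) \<le> K/2 * dist x y"
    if "x \<in> {0..1}" "y \<in> {0..1}" for x y
    using that by (auto simp: lower_half_def upper_half_def dist_real_def simp flip: diff_divide_distrib)
  ultimately show "(K/2)-lipschitz_on {0..1} (lower_half h)" "(K/2)-lipschitz_on {0..1} (upper_half h)"
    by (auto intro: lipschitz_onI)
qed

lemma abs_walsh_coeff_lipschitz_le: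
  assumes "a \<in> J" "a < L" "K-lipschitz_on {0..1} h"
  shows "\<bar>walsh_coeff L J h\<bar> \<le> K * (1/2) ^ Suc a"
  using assms
proof (induction L arbitrary: a J h K)
  case 0
  then show ?case by simp
next
  case (Suc L)
  note lip = \<open>K-lipschitz_on {0..1} h\<close>
  show ?case
  proof (cases a)
    case 0
    have "\<bar>walsh_coeff L (Suc -` J) (\<lambda>x. lower_half h x - upper_half h x)\<bar> \<le> K / 2"
    proof (rule abs_walsh_coeff_le)
      fix x :: real assume "x \<in> {0..1}"
      then show "\<bar>lower_half h x - upper_half h x\<bar> \<le> K / 2"
        using lipschitz_onD[OF lip, of "x/2" "(x+1)/2"]
        by (auto simp: lower_half_def upper_half_def dist_real_def simp flip: diff_divide_distrib)
    qed
    then show ?thesis using 0 Suc.prems(1) by (simp add: walsh_coeff_Suc_of_0_mem)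
  next
    case (Suc b)
    then have "b \<in> Suc -` J" "b < L" using Suc.prems by auto
    then have "\<bar>walsh_coeff L (Suc -` J) (lower_half h)\<bar> \<le> K/2 * (1/2) ^ Suc b"
      "\<bar>walsh_coeff L (Suc -` J) (upper_half h)\<bar> \<le> K/2 * (1/2) ^ Suc b"
      using lipschitz_on_half[OF lip] by (blast intro: Suc.IH)+
    then show ?thesis using abs_walsh_coeff_Suc_le[of L J h] unfolding Suc by simp
  qed
qed

lemma lipschitz_on_of_DERIV:
  fixes h :: "real \<Rightarrow> real"
  assumes "\<And>x. (h has_real_derivative h' x) (at x)" "\<And>x. x \<in> {a..b} \<Longrightarrow> \<bar>h' x\<bar> \<le> K" "0 \<le> K"
  shows "K-lipschitz_on {a..b} h"
proof (rule lipschitz_onI)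
  fix x y assume "x \<in> {a..b}" "y \<in> {a..b}"
  then have "norm (h x - h y) \<le> K * norm (x - y)"
    using assms by (intro field_differentiable_bound[of "{a..b}" h h']) (auto intro: has_field_derivative_at_within)
  then show "dist (h x) (h y) \<le> K * dist x y" by (simp add: dist_norm)
qed (rule assms(3))

lemma DERIV_comp_affine:
  fixes h :: "real \<Rightarrow> real"
  assumes "\<And>x. (h has_real_derivative h' x) (at x)"
  shows "((\<lambda>x. h (a * x + b)) has_real_derivative h' (a * x + b) * a) (at x)"
  by (rule DERIV_chain2[OF assms]) (auto intro!: derivative_eq_intros)

lemma DERIV_half:
  fixes h :: "real \<Rightarrow> real"
  assumes "\<And>x. (h has_real_derivative h' x) (at x)"
  shows "(lower_half h has_real_derivative lower_half h' x / 2) (at x)"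
    "(upper_half h has_real_derivative upper_half h' x / 2) (at x)"
  using DERIV_comp_affine[OF assms, of "1/2" 0 x] DERIV_comp_affine[OF assms, of "1/2" "1/2" x]
  by (simp_all add: lower_half_def[abs_def] upper_half_def[abs_def] add_divide_distrib)

lemma lipschitz_on_half_diff:
  assumes deriv: "\<And>x. (h has_real_derivative h' x) (at x)" and mono: "mono h'"
  shows "((h' 1 - h' 0) / 2)-lipschitz_on {0..1} (\<lambda>x. lower_half h x - upper_half h x)"
proof (rule lipschitz_on_of_DERIV)
  show "((\<lambda>x. lower_half h x - upper_half h x) has_real_derivative lower_half h' x / 2 - upper_half h' x / 2) (at x)" for x
    by (intro DERIV_diff DERIV_half deriv)
  show "\<bar>lower_half h' x / 2 - upper_half h' x / 2\<bar> \<le> (h' 1 - h' 0) / 2" if "x \<in> {0..1}" for x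
    using that monoD[OF mono, of 0 "x/2"] monoD[OF mono, of "x/2" "(x+1)/2"] monoD[OF mono, of "(x+1)/2" 1]
    by (auto simp: lower_half_def upper_half_def)
  show "0 \<le> (h' 1 - h' 0) / 2" using monoD[OF mono, of 0 1] by simp
qed

text \<open>Halving the interval halves the slopes, and the slope variations of the two halves add up to
  at most half the total variation. Hence the bound is stable under consuming a digit; consuming the
  digit \<open>b\<close> turns convexity into a Lipschitz bound for the difference of the two halves.\<close>

lemma abs_walsh_coeff_mono_DERIV_le:
  assumes "a \<in> J" "b \<in> J" "b < a" "a < L"
    and "\<And>x. (h has_real_derivative h' x) (at x)" "mono h'"
  shows "\<bar>walsh_coeff L J h\<bar> \<le> (h' 1 - h' 0) * (1/2) ^ Suc a * (1/2) ^ Suc b"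
  using assms
proof (induction L arbitrary: a b J h h')
  case 0
  then show ?case by simp
next
  case (Suc L)
  note lower = DERIV_half(1)[OF Suc.prems(5)] and upper = DERIV_half(2)[OF Suc.prems(5)]
  obtain c where c: "a = Suc c" using Suc.prems(3) not0_implies_Suc by fastforce
  have cJ: "c \<in> Suc -` J" "c < L" using Suc.prems c by auto
  show ?case
  proof (cases b)
    case 0
    have "\<bar>walsh_coeff L (Suc -` J) (\<lambda>x. lower_half h x - upper_half h x)\<bar> \<le> (h' 1 - h' 0) / 2 * (1/2) ^ Suc c"
      by (rule abs_walsh_coeff_lipschitz_le[OF cJ lipschitz_on_half_diff[OF Suc.prems(5,6)]])
    then show ?thesis
      using 0 c Suc.prems(2) by (simp add: walsh_coeff_Suc_of_0_mem field_simps)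
  next
    case (Suc b')
    then have b: "b' \<in> Suc -` J" "b' < c" using Suc.prems c by auto
    have mono_halves: "mono (\<lambda>x. lower_half h' x / 2)" "mono (\<lambda>x. upper_half h' x / 2)"
      by (auto intro!: monoI monoD[OF Suc.prems(6)] simp: lower_half_def upper_half_def)
    have "lower_half h' 0 = h' 0" "upper_half h' 0 = lower_half h' 1" "upper_half h' 1 = h' 1"
      by (simp_all add: lower_half_def upper_half_def)
    with Suc.IH[OF cJ(1) b cJ(2) lower mono_halves(1)] Suc.IH[OF cJ(1) b cJ(2) upper mono_halves(2)]
    have "\<bar>walsh_coeff L (Suc -` J) (lower_half h)\<bar> + \<bar>walsh_coeff L (Suc -` J) (upper_half h)\<bar>
       \<le> (h' 1 - h' 0) / 2 * (1/2) ^ Suc c * (1/2) ^ Suc b'"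
      by (simp add: field_simps)
    then show ?thesis
      using abs_walsh_coeff_Suc_le[of L J h] unfolding Suc c by simp
  qed
qed

definition C1_convex :: "real \<Rightarrow> (real \<Rightarrow> real) \<Rightarrow> bool" where
  "C1_convex C h \<longleftrightarrow> (\<exists>h'. (\<forall>x. (h has_real_derivative h' x) (at x)) \<and> mono h' \<and>
     (\<forall>x\<in>{0..1}. \<bar>h x\<bar> \<le> C \<and> \<bar>h' x\<bar> \<le> C))"

lemma C1_convex_nonneg: "C1_convex C h \<Longrightarrow> C \<ge> 0"
  unfolding C1_convex_def by (meson abs_ge_zero atLeastAtMost_iff order.refl order_trans zero_le_one)

lemma C1_convex_reflect:
  assumes "C1_convex C h"
  shows "C1_convex C (\<lambda>x. h (1 - x))"
proof -
  obtain h' where h': "\<And>x. (h has_real_derivative h' x) (at x)" "mono h'" "\<forall>x\<in>{0..1}. \<bar>h x\<bar> \<le> C \<and> \<bar>h' x\<bar> \<le> C"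
    using assms unfolding C1_convex_def by blast
  have "((\<lambda>x. h (1 - x)) has_real_derivative - h' (1 - x)) (at x)" for x
    using DERIV_comp_affine[OF h'(1), of "-1" 1 x] by simp
  moreover have "mono (\<lambda>x. - h' (1 - x))" using h'(2) by (auto simp: mono_def)
  ultimately show ?thesis using h'(3) unfolding C1_convex_def by (intro exI[of _ "\<lambda>x. - h' (1 - x)"]) auto
qed

lemma abs_walsh_coeff_C1_convex_le:
  assumes h: "C1_convex C h" and J: "J \<subseteq> {..<L}"
  shows "\<bar>walsh_coeff L J h\<bar> \<le> 2 * C * (1/2) ^ top_sum 2 (Suc ` J)"
proof -
  obtain h' where deriv: "\<And>x. (h has_real_derivative h' x) (at x)" "mono h'"
    and bound: "\<And>x. x \<in> {0..1} \<Longrightarrow> \<bar>h x\<bar> \<le> C" "\<And>x. x \<in> {0..1} \<Longrightarrow> \<bar>h' x\<bar> \<le> C"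
    using h unfolding C1_convex_def by blast
  note C = C1_convex_nonneg[OF h]
  have fin: "finite J" using J finite_subset by blast
  define a where "a = top1 J"
  consider "J = {}" | "J = {a}" | "J \<noteq> {}" "J - {a} \<noteq> {}" by blast
  then show ?thesis
  proof cases
    case 1
    have "\<bar>walsh_coeff L J h\<bar> \<le> C" by (rule abs_walsh_coeff_le) (rule bound(1))
    then show ?thesis using 1 C by (simp add: top_sum_def)
  next
    case 2
    then have "top_sum 2 (Suc ` J) = Suc a" by (simp add: top_sum_2 top1_def top2_def)
    moreover have "\<bar>walsh_coeff L J h\<bar> \<le> C * (1/2) ^ Suc a"
      using 2 J by (intro abs_walsh_coeff_lipschitz_le lipschitz_on_of_DERIV[OF deriv(1) bound(2)] C) auto
    moreover have "C * (1/2) ^ Suc a \<le> 2 * C * (1/2) ^ Suc a" using C by (intro mult_right_mono) auto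
    ultimately show ?thesis by simp
  next
    case 3
    define b where "b = top1 (J - {a})"
    have a: "a \<in> J" and b: "b \<in> J - {a}"
      using top1_in[of J] top1_in[of "J - {a}"] 3 fin by (auto simp: a_def b_def)
    then have "b < a" using le_top1[of J b] fin by (auto simp: a_def)
    have "top_sum 2 (Suc ` J) = Suc a + Suc b"
      using fin 3 by (simp add: top_sum_2 top1_image_Suc top2_image_Suc a_def b_def)
    then have weight: "(1/2::real) ^ top_sum 2 (Suc ` J) = (1/2) ^ Suc a * (1/2) ^ Suc b"
      by (simp only: power_add)
    have "\<bar>walsh_coeff L J h\<bar> \<le> (h' 1 - h' 0) * (1/2) ^ Suc a * (1/2) ^ Suc b"
      using a b J by (intro abs_walsh_coeff_mono_DERIV_le[OF _ _ \<open>b < a\<close> _ deriv]) auto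
    also have "\<dots> \<le> 2 * C * (1/2) ^ Suc a * (1/2) ^ Suc b"
      using bound(2)[of 0] bound(2)[of 1] by (intro mult_right_mono) auto
    finally show ?thesis by (simp only: weight mult.assoc)
  qed
qed

text \<open>The tent map consumes one digit: on the two halves of the interval \<open>h \<circ> tent\<close> is the reflection
  of \<open>h\<close> and \<open>h\<close> itself.\<close>

lemma abs_walsh_coeff_tent_le:
  assumes h: "C1_convex C h" and J: "J \<subseteq> {..<L}"
  shows "\<bar>walsh_coeff L J (\<lambda>y. h \<bar>2 * y - 1\<bar>)\<bar> \<le> 8 * C * (1/2) ^ top_sum 2 (Suc ` J)"
proof (cases L)
  case 0
  have "C \<ge> 0" "\<bar>h 0\<bar> \<le> C" using C1_convex_nonneg[OF h] h by (auto simp: C1_convex_def)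
  then show ?thesis using 0 J by (simp add: walsh_coeff_def walsh_def dyadic_mid_def top_sum_def)
next
  case (Suc K)
  define J' where "J' = Suc -` J"
  have fin: "finite J" and J'_sub: "J' \<subseteq> {..<K}" and J'_image: "Suc ` J' = J - {0}"
    using J finite_subset[OF J] Suc_image_vimage_Suc[of J] by (auto simp: J'_def Suc)
  have "walsh_coeff K J' (lower_half (\<lambda>y. h \<bar>2 * y - 1\<bar>)) = walsh_coeff K J' (\<lambda>x. h (1 - x))"
    "walsh_coeff K J' (upper_half (\<lambda>y. h \<bar>2 * y - 1\<bar>)) = walsh_coeff K J' h"
    by (rule walsh_coeff_cong; simp add: lower_half_def upper_half_def add_divide_distrib)+
  then have "\<bar>walsh_coeff L J (\<lambda>y. h \<bar>2 * y - 1\<bar>)\<bar> \<le> (\<bar>walsh_coeff K J' (\<lambda>x. h (1 - x))\<bar> + \<bar>walsh_coeff K J' h\<bar>) / 2"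
    using abs_walsh_coeff_Suc_le[of K J "\<lambda>y. h \<bar>2 * y - 1\<bar>"] by (simp add: Suc J'_def)
  also have "\<dots> \<le> 2 * C * (1/2) ^ top_sum 2 (Suc ` J')"
    using abs_walsh_coeff_C1_convex_le[OF h J'_sub] abs_walsh_coeff_C1_convex_le[OF C1_convex_reflect[OF h] J'_sub] by simp
  also have "\<dots> = 8 * C * (1/2) ^ (top_sum 2 (J - {0}) + 2)"
    by (simp add: J'_image power_add power2_eq_square)
  also have "\<dots> \<le> 8 * C * (1/2) ^ top_sum 2 (Suc ` J)"
    using C1_convex_nonneg[OF h] top_sum_2_image_Suc_le[OF fin] by (intro mult_left_mono power_decreasing) auto
  finally show ?thesis .
qed

section \<open>Walsh expansion of the net error\<close>

definition digit_sets :: "nat \<Rightarrow> ('d::finite \<Rightarrow> nat set) set" where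
  "digit_sets L = PiE UNIV (\<lambda>_. Pow {..<L})"

definition walsh_prod :: "('d::finite \<Rightarrow> nat set) \<Rightarrow> ('d \<Rightarrow> nat set) \<Rightarrow> real" where
  "walsh_prod T A = (\<Prod>i\<in>UNIV. walsh (T i) (A i))"

lemma digit_sets_iff: "A \<in> digit_sets L \<longleftrightarrow> (\<forall>i. A i \<subseteq> {..<L})"
  by (auto simp: digit_sets_def PiE_iff)

lemma finite_digit_sets: "finite (digit_sets L :: ('d::finite \<Rightarrow> nat set) set)"
  by (simp add: digit_sets_def finite_PiE)

lemma finite_digit_set: "T \<in> digit_sets L \<Longrightarrow> finite (T i)"
  unfolding digit_sets_iff by (blast intro: finite_subset[OF _ finite_lessThan])

lemma finite_Sigma_digit_sets: "T \<in> digit_sets L \<Longrightarrow> finite (Sigma (UNIV :: 'd::finite set) T)"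
  by (intro finite_SigmaI) (auto simp: finite_digit_set)

lemma walsh_mult:
  assumes "finite T"
  shows "walsh T A * walsh T B = walsh T (sym_diff A B)"
  unfolding walsh_eq_prod[OF assms] by (subst prod.distrib[symmetric]) (auto intro: prod.cong)

lemma sum_Pow_prod:
  fixes c :: "'a \<Rightarrow> 'b::comm_semiring_1"
  assumes "finite U"
  shows "(\<Sum>T\<in>Pow U. \<Prod>l\<in>T. c l) = (\<Prod>l\<in>U. 1 + c l)"
  using prod_add[OF assms, of c "\<lambda>_. 1"] by (simp add: add.commute[of 1])

lemma sum_Pow_walsh:
  assumes "finite U" "A \<subseteq> U"
  shows "(\<Sum>T\<in>Pow U. walsh T A) = (if A = {} then 2 ^ card U else 0)"
proof -
  have "(\<Sum>T\<in>Pow U. walsh T A) = (\<Sum>T\<in>Pow U. \<Prod>l\<in>T. if l \<in> A then -1 else 1)"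
    using assms(1) by (intro sum.cong refl walsh_eq_prod) (auto intro: finite_subset)
  also have "\<dots> = (\<Prod>l\<in>U. 1 + (if l \<in> A then -1 else 1))" by (rule sum_Pow_prod[OF assms(1)])
  also have "\<dots> = (if A = {} then 2 ^ card U else 0)"
  proof (cases "A = {}")
    case False
    then have "\<exists>l\<in>U. 1 + (if l \<in> A then -1 else 1) = (0::real)" using assms(2) by force
    then show ?thesis using False prod_zero[OF assms(1)] by simp
  qed simp
  finally show ?thesis .
qed

lemma walsh_orthogonal:
  assumes "finite U" "A \<subseteq> U" "B \<subseteq> U"
  shows "(\<Sum>T\<in>Pow U. walsh T A * walsh T B) = (if A = B then 2 ^ card U else 0)"
proof -
  have "(\<Sum>T\<in>Pow U. walsh T A * walsh T B) = (\<Sum>T\<in>Pow U. walsh T (sym_diff A B))"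
    using assms(1) by (intro sum.cong refl walsh_mult) (auto intro: finite_subset)
  also have "\<dots> = (if sym_diff A B = {} then 2 ^ card U else 0)"
    using assms by (intro sum_Pow_walsh) auto
  also have "sym_diff A B = {} \<longleftrightarrow> A = B" by auto
  finally show ?thesis .
qed

lemma walsh_inversion:
  assumes "A \<subseteq> {..<L}"
  shows "h (dyadic_mid L A) = (\<Sum>T\<in>Pow {..<L}. walsh_coeff L T h * walsh T A)"
proof -
  have "(\<Sum>T\<in>Pow {..<L}. walsh_coeff L T h * walsh T A)
     = (\<Sum>T\<in>Pow {..<L}. \<Sum>B\<in>Pow {..<L}. h (dyadic_mid L B) / 2 ^ L * (walsh T B * walsh T A))"
    unfolding walsh_coeff_def sum_divide_distrib sum_distrib_right
    by (intro sum.cong refl) (simp add: algebra_simps)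
  also have "\<dots> = (\<Sum>B\<in>Pow {..<L}. h (dyadic_mid L B) / 2 ^ L * (\<Sum>T\<in>Pow {..<L}. walsh T B * walsh T A))"
    by (subst sum.swap) (simp add: sum_distrib_left)
  also have "\<dots> = (\<Sum>B\<in>Pow {..<L}. if B = A then h (dyadic_mid L B) else 0)"
    by (rule sum.cong[OF refl]) (use assms in \<open>simp add: walsh_orthogonal\<close>)
  also have "\<dots> = h (dyadic_mid L A)" using assms by (simp add: sum.delta')
  finally show ?thesis by simp
qed

lemma walsh_prod_inversion:
  assumes "A \<in> digit_sets L"
  shows "(\<Prod>i\<in>UNIV. h i (dyadic_mid L (A i)))
       = (\<Sum>T\<in>digit_sets L. (\<Prod>i\<in>UNIV. walsh_coeff L (T i) (h i)) * walsh_prod T A)"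
proof -
  have "h i (dyadic_mid L (A i)) = (\<Sum>T\<in>Pow {..<L}. walsh_coeff L T (h i) * walsh T (A i))" for i
    using assms unfolding digit_sets_iff by (blast intro: walsh_inversion)
  then show ?thesis by (simp add: prod_sum_PiE digit_sets_def walsh_prod_def prod.distrib)
qed

lemma sum_digit_sets_walsh_prod:
  fixes T :: "'d::finite \<Rightarrow> nat set"
  assumes "T \<in> digit_sets L"
  shows "(\<Sum>A\<in>digit_sets L. walsh_prod T A) = (if T = (\<lambda>_. {}) then 2 ^ (L * CARD('d)) else 0)"
proof -
  have "(\<Sum>A\<in>digit_sets L. walsh_prod T A) = (\<Prod>i\<in>UNIV. \<Sum>A\<in>Pow {..<L}. walsh A (T i))"
    by (simp add: digit_sets_def walsh_prod_def prod_sum_PiE walsh_commute)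
  also have "\<dots> = (\<Prod>i\<in>UNIV. if T i = {} then 2 ^ L else 0)"
    using assms by (intro prod.cong refl) (simp add: sum_Pow_walsh digit_sets_iff)
  also have "\<dots> = (if T = (\<lambda>_. {}) then 2 ^ (L * CARD('d)) else 0)"
  proof (cases "T = (\<lambda>_. {})")
    case False
    then have "\<exists>i. T i \<noteq> {}" by auto
    then show ?thesis using False by (auto intro: prod_zero)
  qed (simp add: power_mult)
  finally show ?thesis .
qed

text \<open>Rows beyond \<open>2 * n\<close> are treated as zero, since net points have no digits there.\<close>

definition net_column :: "nat \<Rightarrow> ('d \<Rightarrow> nat \<Rightarrow> nat \<Rightarrow> bool) \<Rightarrow> nat \<Rightarrow> ('d \<times> nat) set" where
  "net_column n Cm r = {(i, l). l < 2 * n \<and> Cm i (Suc l) r}"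

definition dual_net :: "nat \<Rightarrow> ('d::finite \<Rightarrow> nat \<Rightarrow> nat \<Rightarrow> bool) \<Rightarrow> nat \<Rightarrow> ('d \<Rightarrow> nat set) set" where
  "dual_net n Cm L = {T \<in> digit_sets L. \<forall>r<n. walsh (net_column n Cm r) (Sigma UNIV T) = 1}"

definition net_digits :: "nat \<Rightarrow> ('d \<Rightarrow> nat \<Rightarrow> nat \<Rightarrow> bool) \<Rightarrow> nat \<Rightarrow> 'd \<Rightarrow> nat set" where
  "net_digits n Cm k i = {l. l < 2 * n \<and> digit n Cm i (Suc l) k}"

lemma walsh_eq_1_iff: "walsh T A = 1 \<longleftrightarrow> even (card (A \<inter> T))"
  by (simp add: walsh_def minus_one_power_iff)

lemma finite_net_column: "finite (net_column n Cm r :: ('d::finite \<times> nat) set)"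
  by (rule finite_subset[of _ "UNIV \<times> {..<2 * n}"]) (auto simp: net_column_def)

lemma zero_in_dual_net: "(\<lambda>_. {}) \<in> dual_net n Cm L"
  by (simp add: dual_net_def digit_sets_iff walsh_eq_1_iff)

lemma net_digits_in_digit_sets: "2 * n \<le> L \<Longrightarrow> net_digits n Cm k \<in> digit_sets L"
  by (auto simp: digit_sets_iff net_digits_def)

lemma dual_net_sym_diff:
  assumes "S \<in> dual_net n Cm L" "T \<in> dual_net n Cm L"
  shows "(\<lambda>i. sym_diff (S i) (T i)) \<in> dual_net n Cm L"
proof -
  have "Sigma UNIV (\<lambda>i. sym_diff (S i) (T i)) = sym_diff (Sigma UNIV S) (Sigma UNIV T)" by auto
  then have "walsh (net_column n Cm r) (Sigma UNIV (\<lambda>i. sym_diff (S i) (T i)))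
      = walsh (net_column n Cm r) (Sigma UNIV S) * walsh (net_column n Cm r) (Sigma UNIV T)" for r
    by (simp add: walsh_mult finite_net_column)
  moreover have "(\<lambda>i. sym_diff (S i) (T i)) \<in> digit_sets L"
    using assms unfolding dual_net_def digit_sets_iff by blast
  ultimately show ?thesis using assms by (simp add: dual_net_def)
qed

lemma bij_betw_set_decode: "bij_betw set_decode {..<2 ^ n} (Pow {..<n})"
proof -
  have inj: "inj_on set_decode {..<2 ^ n}" by (metis inj_onI set_decode_inverse)
  have sub: "set_decode ` {..<2 ^ n} \<subseteq> Pow {..<n}"
  proof clarify
    fix k r assume k: "k < 2 ^ n" and r: "r \<in> set_decode k"
    have "k div 2 ^ r \<noteq> 0" using r by (intro notI) (simp add: set_decode_def)
    then have "2 ^ r \<le> k" by (metis div_less not_le)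
    then have "(2::nat) ^ r < 2 ^ n" using k by (rule le_less_trans)
    then show "r < n" by simp
  qed
  have "set_decode ` {..<2 ^ n} = Pow {..<n}"
    by (rule card_subset_eq[OF _ sub]) (simp_all add: card_image[OF inj] card_Pow)
  with inj show ?thesis by (simp add: bij_betw_def)
qed

lemma net_digit_sign:
  assumes "k < 2 ^ n"
  shows "(if l \<in> net_digits n Cm k i then -1 else (1::real))
       = (\<Prod>r\<in>set_decode k. if (i, l) \<in> net_column n Cm r then -1 else 1)"
proof (cases "l < 2 * n")
  case True
  have "set_decode k \<subseteq> {..<n}" using assms bij_betw_set_decode[of n] by (auto simp: bij_betw_def)
  then have "{r. (i, l) \<in> net_column n Cm r} \<inter> set_decode k = {r. r < n \<and> Cm i (Suc l) r \<and> odd (k div 2 ^ r)}"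
    using True by (auto simp: net_column_def set_decode_def)
  then have "(if l \<in> net_digits n Cm k i then -1 else (1::real)) = walsh (set_decode k) {r. (i, l) \<in> net_column n Cm r}"
    using True by (simp add: walsh_def net_digits_def digit_def)
  then show ?thesis by (simp add: walsh_eq_prod)
qed (simp add: net_digits_def net_column_def)

lemma walsh_prod_net_digits:
  fixes Cm :: "'d::finite \<Rightarrow> nat \<Rightarrow> nat \<Rightarrow> bool"
  assumes "T \<in> digit_sets L" "k < 2 ^ n"
  shows "walsh_prod T (net_digits n Cm k) = (\<Prod>r\<in>set_decode k. walsh (net_column n Cm r) (Sigma UNIV T))"
proof -
  note fin = finite_digit_set[OF assms(1)] finite_Sigma_digit_sets[OF assms(1)]
  have "walsh_prod T (net_digits n Cm k)
      = (\<Prod>i\<in>UNIV. \<Prod>l\<in>T i. \<Prod>r\<in>set_decode k. if (i, l) \<in> net_column n Cm r then -1 else 1)"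
    by (simp only: walsh_prod_def walsh_eq_prod[OF fin(1)] net_digit_sign[OF assms(2)])
  also have "\<dots> = (\<Prod>p\<in>Sigma UNIV T. \<Prod>r\<in>set_decode k. if p \<in> net_column n Cm r then -1 else 1)"
    by (subst prod.Sigma) (use fin in \<open>auto simp: split_def\<close>)
  also have "\<dots> = (\<Prod>r\<in>set_decode k. walsh (Sigma UNIV T) (net_column n Cm r))"
    by (subst prod.swap) (simp add: walsh_eq_prod[OF fin(2)])
  finally show ?thesis by (simp only: walsh_commute)
qed

lemma sum_net_walsh_prod:
  fixes Cm :: "'d::finite \<Rightarrow> nat \<Rightarrow> nat \<Rightarrow> bool"
  assumes T: "T \<in> digit_sets L"
  shows "(\<Sum>k<2 ^ n. walsh_prod T (net_digits n Cm k)) = (if T \<in> dual_net n Cm L then 2 ^ n else 0)"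
proof -
  define \<sigma> where "\<sigma> r = walsh (net_column n Cm r) (Sigma UNIV T)" for r
  have "(\<Sum>k<2 ^ n. walsh_prod T (net_digits n Cm k)) = (\<Sum>k<2 ^ n. \<Prod>r\<in>set_decode k. \<sigma> r)"
    by (simp add: walsh_prod_net_digits[OF T] \<sigma>_def)
  also have "\<dots> = (\<Sum>K\<in>Pow {..<n}. \<Prod>r\<in>K. \<sigma> r)"
    by (rule sum.reindex_bij_betw[OF bij_betw_set_decode])
  also have "\<dots> = (\<Prod>r<n. 1 + \<sigma> r)"
    by (rule sum_Pow_prod) simp
  also have "\<dots> = (if T \<in> dual_net n Cm L then 2 ^ n else 0)"
  proof (cases "T \<in> dual_net n Cm L")
    case True
    then show ?thesis by (simp add: dual_net_def \<sigma>_def)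
  next
    case False
    then obtain r where "r < n" "\<sigma> r \<noteq> 1" using T by (auto simp: dual_net_def \<sigma>_def)
    moreover from this have "1 + \<sigma> r = 0" by (simp add: \<sigma>_def walsh_def minus_one_power_iff split: if_splits)
    ultimately show ?thesis using False by (auto intro!: prod_zero)
  qed
  finally show ?thesis .
qed

definition grid_weight :: "nat \<Rightarrow> ('d::finite \<Rightarrow> nat \<Rightarrow> nat \<Rightarrow> bool) \<Rightarrow> nat \<Rightarrow> ('d \<Rightarrow> nat set) \<Rightarrow> real" where
  "grid_weight n Cm L A = real (card {k \<in> {..<2 ^ n}. net_digits n Cm k = A}) / 2 ^ n - 1 / 2 ^ (L * CARD('d))"

lemma sum_grid_weight:
  fixes Cm :: "'d::finite \<Rightarrow> nat \<Rightarrow> nat \<Rightarrow> bool"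
  assumes "2 * n \<le> L"
  shows "(\<Sum>A\<in>digit_sets L. grid_weight n Cm L A * F A)
       = (\<Sum>k<2 ^ n. F (net_digits n Cm k)) / 2 ^ n - (\<Sum>A\<in>digit_sets L. F A) / 2 ^ (L * CARD('d))"
proof -
  have "(\<Sum>k<2 ^ n. F (net_digits n Cm k))
      = (\<Sum>A\<in>digit_sets L. \<Sum>k\<in>{k \<in> {..<2 ^ n}. net_digits n Cm k = A}. F (net_digits n Cm k))"
    using net_digits_in_digit_sets[OF assms] by (intro sum.group[symmetric]) (auto simp: finite_digit_sets)
  also have "\<dots> = (\<Sum>A\<in>digit_sets L. card {k \<in> {..<2 ^ n}. net_digits n Cm k = A} * F A)"
    by (intro sum.cong) auto
  finally show ?thesis
    by (simp add: grid_weight_def left_diff_distrib sum_subtractf sum_divide_distrib)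
qed

lemma sum_grid_weight_walsh_prod:
  fixes Cm :: "'d::finite \<Rightarrow> nat \<Rightarrow> nat \<Rightarrow> bool"
  assumes "T \<in> digit_sets L" "2 * n \<le> L"
  shows "(\<Sum>A\<in>digit_sets L. grid_weight n Cm L A * walsh_prod T A) = (if T \<in> dual_net n Cm L - {\<lambda>_. {}} then 1 else 0)"
  using zero_in_dual_net[of n Cm L]
  by (auto simp: sum_grid_weight[OF assms(2)] sum_net_walsh_prod[OF assms(1)] sum_digit_sets_walsh_prod[OF assms(1)])

lemma sum_grid_weight_prod:
  fixes Cm :: "'d::finite \<Rightarrow> nat \<Rightarrow> nat \<Rightarrow> bool" and h :: "'d \<Rightarrow> real \<Rightarrow> real"
  assumes L: "2 * n \<le> L"
  shows "(\<Sum>A\<in>digit_sets L. grid_weight n Cm L A * (\<Prod>i\<in>UNIV. h i (dyadic_mid L (A i))))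
       = (\<Sum>T\<in>dual_net n Cm L - {\<lambda>_. {}}. \<Prod>i\<in>UNIV. walsh_coeff L (T i) (h i))"
proof -
  define c where "c T = (\<Prod>i\<in>UNIV. walsh_coeff L (T i) (h i))" for T
  have "(\<Sum>A\<in>digit_sets L. grid_weight n Cm L A * (\<Prod>i\<in>UNIV. h i (dyadic_mid L (A i))))
      = (\<Sum>A\<in>digit_sets L. \<Sum>T\<in>digit_sets L. c T * (grid_weight n Cm L A * walsh_prod T A))"
    by (intro sum.cong refl) (simp add: walsh_prod_inversion c_def sum_distrib_left mult_ac)
  also have "\<dots> = (\<Sum>T\<in>digit_sets L. c T * (\<Sum>A\<in>digit_sets L. grid_weight n Cm L A * walsh_prod T A))"
    by (subst sum.swap) (simp add: sum_distrib_left)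
  also have "\<dots> = (\<Sum>T\<in>digit_sets L. if T \<in> dual_net n Cm L - {\<lambda>_. {}} then c T else 0)"
    by (intro sum.cong refl) (simp add: sum_grid_weight_walsh_prod[OF _ L])
  also have "\<dots> = (\<Sum>T\<in>dual_net n Cm L - {\<lambda>_. {}}. c T)"
    by (subst sum.inter_restrict[symmetric])
      (auto simp: finite_digit_sets dual_net_def intro!: sum.cong)
  finally show ?thesis by (simp add: c_def)
qed

section \<open>The weight of the dual net\<close>

definition weight2 :: "('d::finite \<Rightarrow> nat set) \<Rightarrow> nat" where
  "weight2 T = (\<Sum>i\<in>UNIV. top_sum 2 (Suc ` T i))"

lemma card_Sigma_Int_net_column:
  assumes "\<And>i. T i \<subseteq> {..<2 * n}"
  shows "card (Sigma UNIV T \<inter> net_column n Cm r) = card {p \<in> Sigma UNIV (\<lambda>i. Suc ` T i). Cm (fst p) (snd p) r}"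
proof (rule bij_betw_same_card[of "\<lambda>p. (fst p, Suc (snd p))"], rule bij_betw_imageI)
  show "inj_on (\<lambda>p. (fst p, Suc (snd p))) (Sigma UNIV T \<inter> net_column n Cm r)"
    by (auto simp: inj_on_def prod_eq_iff)
  have "l < 2 * n" if "l \<in> T i" for i l using assms[of i] that by auto
  then show "(\<lambda>p. (fst p, Suc (snd p))) ` (Sigma UNIV T \<inter> net_column n Cm r)
      = {p \<in> Sigma UNIV (\<lambda>i. Suc ` T i). Cm (fst p) (snd p) r}"
    by (auto simp: net_column_def image_iff Bex_def)
qed

lemma weight2_dual_net_gt:
  fixes Cm :: "'d::finite \<Rightarrow> nat \<Rightarrow> nat \<Rightarrow> bool"
  assumes net: "is_order_digital_net 2 t n Cm" and T: "T \<in> dual_net n Cm L" "T \<noteq> (\<lambda>_. {})"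
  shows "weight2 T > 2 * n - t"
proof (rule ccontr)
  assume "\<not> weight2 T > 2 * n - t"
  then have weight: "weight2 T \<le> 2 * n - t" by simp
  define J where "J i = Suc ` T i" for i
  have fin: "finite (J i)" for i using T(1) by (auto simp: J_def dual_net_def intro: finite_digit_set)
  have top: "top_sum 2 (J i) \<le> weight2 T" for i
    unfolding weight2_def J_def by (rule member_le_sum) auto
  have le_weight: "l \<le> weight2 T" if "l \<in> J i" for i l
    using le_top_sum_2[OF fin that] top[of i] by linarith
  obtain i\<^sub>0 l\<^sub>0 where l\<^sub>0: "l\<^sub>0 \<in> T i\<^sub>0" using T(2) by fastforce
  then have "t \<le> 2 * n" using le_weight[of "Suc l\<^sub>0" i\<^sub>0] weight by (simp add: J_def)
  then have "int (\<Sum>i\<in>UNIV. top_sum 2 (J i)) \<le> int (2 * n) - int t"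
    using weight unfolding weight2_def J_def by linarith
  moreover have J: "J i \<subseteq> {1..2 * n}" for i
    using le_weight[of _ i] weight by (force simp: J_def)
  moreover have "card (J i) \<le> n" for i
    using top[of i] weight by (intro card_le_half_top_sum_2 fin) (auto simp: J_def)
  ultimately have "rows_independent n Cm (Sigma UNIV J)"
    using net unfolding is_order_digital_net_def by blast
  moreover have "Sigma UNIV J \<noteq> {}" using l\<^sub>0 unfolding J_def by blast
  ultimately obtain r where r: "r < n" "odd (card {p \<in> Sigma UNIV J. Cm (fst p) (snd p) r})"
    unfolding rows_independent_def by blast
  have "T i \<subseteq> {..<2 * n}" for i using J[of i] by (auto simp: J_def)
  then have "odd (card (Sigma UNIV T \<inter> net_column n Cm r))"
    using r(2) by (simp add: card_Sigma_Int_net_column J_def[abs_def])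
  then show False using r(1) T(1) by (simp add: dual_net_def walsh_eq_1_iff)
qed

section \<open>Summation over separated sets\<close>

lemma exists_le_with_sum:
  fixes b :: "'a \<Rightarrow> nat"
  assumes "finite S" "q \<le> sum b S"
  obtains c where "\<And>i. i \<in> S \<Longrightarrow> c i \<le> b i" "sum c S = q"
  using assms
proof (induction S arbitrary: q thesis rule: finite_induct)
  case empty
  then show ?case by simp
next
  case (insert x S)
  define c\<^sub>x where "c\<^sub>x = min (b x) q"
  have "q - c\<^sub>x \<le> sum b S" using insert.prems(2) insert.hyps by (simp add: c\<^sub>x_def)
  from insert.IH[OF _ this] obtain c where c: "\<And>i. i \<in> S \<Longrightarrow> c i \<le> b i" "sum c S = q - c\<^sub>x" by blast
  have "sum (c(x := c\<^sub>x)) (insert x S) = c\<^sub>x + sum c S"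
    using insert.hyps by (auto intro!: sum.cong)
  then show ?case
    using c by (intro insert.prems(1)[of "c(x := c\<^sub>x)"]) (auto simp: c\<^sub>x_def)
qed

lemma
  finite_compositions: "finite {p :: 'a::finite \<Rightarrow> nat. sum p UNIV = m}" and
  card_compositions_le: "card {p :: 'a::finite \<Rightarrow> nat. sum p UNIV = m} \<le> (m + 1) ^ (CARD('a) - 1)"
proof -
  let ?P = "{p :: 'a \<Rightarrow> nat. sum p UNIV = m}"
  fix x\<^sub>0 :: 'a
  let ?R = "PiE (UNIV - {x\<^sub>0}) (\<lambda>_. {..m})"
  define r where "r p = restrict p (UNIV - {x\<^sub>0})" for p :: "'a \<Rightarrow> nat"
  have inj: "inj_on r ?P"
  proof (rule inj_onI)
    fix p q assume p: "p \<in> ?P" and q: "q \<in> ?P" and "r p = r q"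
    then have eq: "p x = q x" if "x \<noteq> x\<^sub>0" for x
      using that by (auto simp: r_def dest: fun_cong[of _ _ x])
    then have "sum p (UNIV - {x\<^sub>0}) = sum q (UNIV - {x\<^sub>0})" by (intro sum.cong) auto
    then have "p x\<^sub>0 = q x\<^sub>0" using p q by (simp add: sum.remove[of UNIV x\<^sub>0])
    with eq show "p = q" by (metis ext)
  qed
  have "p x \<le> sum p UNIV" for p :: "'a \<Rightarrow> nat" and x by (rule member_le_sum) auto
  then have sub: "r ` ?P \<subseteq> ?R" by (auto simp: r_def split: if_splits)
  have fin: "finite ?R" by (intro finite_PiE) auto
  show "finite ?P" using inj_on_finite[OF inj sub fin] .
  have "card ?P \<le> card ?R" by (rule card_inj_on_le[OF inj sub fin])
  also have "\<dots> = (m + 1) ^ (CARD('a) - 1)" by (simp add: card_PiE card_Diff_singleton)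
  finally show "card ?P \<le> (m + 1) ^ (CARD('a) - 1)" .
qed

definition separated :: "nat \<Rightarrow> ('d::finite \<Rightarrow> nat set) set \<Rightarrow> bool" where
  "separated M D \<longleftrightarrow> (\<forall>S\<in>D. \<forall>T\<in>D. S \<noteq> T \<longrightarrow> M < weight2 (\<lambda>i. sym_diff (S i) (T i)))"

definition leading :: "('d \<Rightarrow> nat set) \<Rightarrow> 'd \<times> bool \<Rightarrow> nat" where
  "leading T = (\<lambda>(i, u). if u then top1 (Suc ` T i) else top2 (Suc ` T i))"

lemma separated_subset: "separated M D \<Longrightarrow> E \<subseteq> D \<Longrightarrow> separated M E"
  unfolding separated_def by blast

lemma sum_leading:
  assumes "T \<in> digit_sets L"
  shows "sum (leading T) UNIV = weight2 T"
proof -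
  have "sum (leading T) UNIV = (\<Sum>i\<in>UNIV. \<Sum>u\<in>UNIV. leading T (i, u))"
    by (simp add: sum.cartesian_product)
  then show ?thesis
    using finite_digit_set[OF assms] by (simp add: UNIV_bool leading_def weight2_def top_sum_2 add.commute)
qed

lemma twice_sum_leading_False_le:
  assumes "T \<in> digit_sets L"
  shows "2 * (\<Sum>i\<in>UNIV. leading T (i, False)) \<le> weight2 T"
  unfolding weight2_def sum_distrib_left using finite_digit_set[OF assms]
  by (intro sum_mono) (simp add: leading_def top_sum_2 top2_le_top1)

lemma weight2_le:
  assumes "\<And>i. Suc ` T i \<subseteq> {..c i}"
  shows "weight2 T \<le> 2 * (\<Sum>i\<in>UNIV. c i)"
  unfolding weight2_def sum_distrib_left
proof (rule sum_mono)
  fix i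
  have "finite (Suc ` T i)" using assms finite_subset by blast
  then show "top_sum 2 (Suc ` T i) \<le> 2 * c i"
    using top1_le[OF _ assms] top2_le[OF _ assms] by (simp add: top_sum_2 add_mono mult_2)
qed

text \<open>Two elements with the same leading digits that also agree above \<open>c i\<close> differ only in digits up to
  \<open>c i\<close>, so their difference has weight at most \<open>2 * sum c UNIV\<close>; choosing \<open>c\<close> with \<open>sum c UNIV = M div 2\<close>,
  or \<open>c = b\<close> if this is impossible, makes them equal.\<close>

lemma card_same_leading_le:
  fixes D :: "('d::finite \<Rightarrow> nat set) set"
  assumes D: "D \<subseteq> digit_sets L" "separated M D" and leading: "\<And>T. T \<in> D \<Longrightarrow> leading T = p"
  shows "card D \<le> 2 ^ ((\<Sum>i\<in>UNIV. p (i, False)) - M div 2)"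
proof -
  define b where "b i = p (i, False)" for i
  obtain c where c: "\<And>i. c i \<le> b i" "sum c UNIV = min (sum b UNIV) (M div 2)"
    using exists_le_with_sum[of UNIV "min (sum b UNIV) (M div 2)" b] by auto
  define r where "r T = (\<lambda>i. Suc ` T i \<inter> {c i<..b i})" for T :: "'d \<Rightarrow> nat set"
  have mem_iff: "l \<in> T i \<longleftrightarrow> Suc l \<in> Suc ` T i \<inter> {..b i} \<or> Suc l = p (i, True)" if "T \<in> D" for T i l
  proof -
    have "finite (Suc ` T i)" using that D(1) by (auto intro: finite_digit_set)
    moreover have "top1 (Suc ` T i) = p (i, True)" "top2 (Suc ` T i) = b i"
      using leading[OF that, symmetric] by (simp_all add: b_def leading_def)
    ultimately show ?thesis using mem_iff_top[of "Suc ` T i" "Suc l"] by auto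
  qed
  have "inj_on r D"
  proof (rule inj_onI, rule ccontr)
    fix S T assume S: "S \<in> D" and T: "T \<in> D" and "r S = r T" and "S \<noteq> T"
    have "Suc ` sym_diff (S i) (T i) \<subseteq> {..c i}" for i
    proof
      fix k assume "k \<in> Suc ` sym_diff (S i) (T i)"
      then obtain l where l: "k = Suc l" "(l \<in> S i) \<noteq> (l \<in> T i)" by auto
      have "Suc ` S i \<inter> {c i<..b i} = Suc ` T i \<inter> {c i<..b i}"
        using \<open>r S = r T\<close> unfolding r_def by metis
      then show "k \<in> {..c i}" using l mem_iff[OF S, of l i] mem_iff[OF T, of l i] by auto
    qed
    then have "weight2 (\<lambda>i. sym_diff (S i) (T i)) \<le> 2 * sum c UNIV" by (rule weight2_le)
    also have "\<dots> \<le> M" using c(2) by linarith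
    finally show False using D(2) S T \<open>S \<noteq> T\<close> by (auto simp: separated_def not_less[symmetric])
  qed
  moreover have "r ` D \<subseteq> PiE UNIV (\<lambda>i. Pow {c i<..b i})" by (auto simp: r_def)
  ultimately have "card D \<le> card (PiE UNIV (\<lambda>i. Pow {c i<..b i}))"
    by (intro card_inj_on_le) (auto intro!: finite_PiE)
  also have "\<dots> = 2 ^ (\<Sum>i\<in>UNIV. b i - c i)" by (simp add: card_PiE card_Pow power_sum)
  also have "(\<Sum>i\<in>UNIV. b i - c i) = sum b UNIV - sum c UNIV" using c(1) by (intro sum_subtractf_nat) auto
  also have "\<dots> = sum b UNIV - M div 2" by (simp add: c(2))
  finally show ?thesis by (simp add: b_def)
qed

lemma card_weight2_eq_le:
  fixes D :: "('d::finite \<Rightarrow> nat set) set"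
  assumes D: "D \<subseteq> digit_sets L" "separated M D"
  shows "card {T \<in> D. weight2 T = M + j} \<le> (M + j + 1) ^ (2 * CARD('d) - 1) * 2 ^ ((j + 1) div 2)"
proof -
  let ?P = "{p :: 'd \<times> bool \<Rightarrow> nat. sum p UNIV = M + j}"
  let ?F = "\<lambda>p. {T \<in> D. weight2 T = M + j \<and> leading T = p}"
  have fibre: "card (?F p) \<le> 2 ^ ((j + 1) div 2)" for p
  proof (cases "?F p = {}")
    case False
    then obtain T where T: "T \<in> D" "weight2 T = M + j" "leading T = p" by blast
    then have "2 * (\<Sum>i\<in>UNIV. p (i, False)) \<le> M + j"
      using twice_sum_leading_False_le[of T L] D(1) by auto
    then have "(\<Sum>i\<in>UNIV. p (i, False)) - M div 2 \<le> (j + 1) div 2" by linarith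
    moreover have "card (?F p) \<le> 2 ^ ((\<Sum>i\<in>UNIV. p (i, False)) - M div 2)"
      using D by (intro card_same_leading_le) (auto intro: separated_subset)
    ultimately show ?thesis by (meson le_trans one_le_numeral power_increasing)
  qed (simp only: card.empty zero_le)
  have "{T \<in> D. weight2 T = M + j} = (\<Union>p\<in>?P. ?F p)"
    using D(1) sum_leading by fastforce
  then have "card {T \<in> D. weight2 T = M + j} \<le> (\<Sum>p\<in>?P. card (?F p))"
    by (simp only: card_UN_le[OF finite_compositions])
  also have "\<dots> \<le> card ?P * 2 ^ ((j + 1) div 2)"
    using sum_bounded_above[of ?P "\<lambda>p. card (?F p)"] fibre by simp
  also have "\<dots> \<le> (M + j + 1) ^ (2 * CARD('d) - 1) * 2 ^ ((j + 1) div 2)"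
    using card_compositions_le[where 'a = "'d \<times> bool", of "M + j"] by (simp add: mult.commute)
  finally show ?thesis .
qed

lemma summable_poly_half_power: "summable (\<lambda>j. (real j + 1) ^ q * (1/2) ^ (j div 2))"
proof (rule summable_comparison_test_bigo)
  show "summable (\<lambda>j. norm ((7/8::real) ^ j))" by (simp add: summable_geometric)
  have half: "(1/2::real) ^ (j div 2) \<le> 2 * (3/4) ^ j" for j
  proof (induction j rule: nat_induct2)
    fix j assume IH: "(1/2::real) ^ (j div 2) \<le> 2 * (3/4) ^ j"
    have "(1/2::real) ^ ((j + 2) div 2) \<le> (9/16) * (1/2) ^ (j div 2)" by simp
    also have "\<dots> \<le> (9/16) * (2 * (3/4) ^ j)" using IH by (rule mult_left_mono) simp
    finally show "(1/2::real) ^ ((j + 2) div 2) \<le> 2 * (3/4) ^ (j + 2)" by (simp add: power2_eq_square)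
  qed simp_all
  have "(\<lambda>j. (real j + 1) ^ q * (1/2) ^ (j div 2)) \<in> O(\<lambda>j. (real j + 1) ^ q * (3/4) ^ j)"
    by (intro landau_o.big.mult_left bigoI[of _ 2] always_eventually allI) (use half in auto)
  also have "(\<lambda>j. (real j + 1) ^ q * (3/4) ^ j) \<in> O(\<lambda>j. (7/8) ^ j)"
    by real_asymp
  finally show "(\<lambda>j. (real j + 1) ^ q * (1/2) ^ (j div 2)) \<in> O(\<lambda>j. (7/8) ^ j)" .
qed

definition separated_const :: "nat \<Rightarrow> real" where
  "separated_const q = (\<Sum>j. (real j + 1) ^ q * (1/2) ^ (j div 2))"

lemma separated_const_pos: "separated_const q > 0"
  unfolding separated_const_def by (rule suminf_pos[OF summable_poly_half_power]) (simp add: add_nonneg_pos)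

lemma sum_half_power_weight2_le:
  fixes D :: "('d::finite \<Rightarrow> nat set) set"
  assumes D: "D \<subseteq> digit_sets L" "separated M D" and M: "\<And>T. T \<in> D \<Longrightarrow> M \<le> weight2 T"
  defines "q \<equiv> 2 * CARD('d) - 1"
  shows "(\<Sum>T\<in>D. (1/2) ^ weight2 T) \<le> separated_const q * ((1/2) ^ M * (real M + 1) ^ q)"
proof -
  have fin: "finite D" using D(1) finite_digit_sets finite_subset by blast
  define K where "K = (1/2::real) ^ M * (real M + 1) ^ q"
  have level: "(\<Sum>T\<in>{T \<in> D. weight2 T - M = j}. (1/2::real) ^ weight2 T) \<le> K * ((real j + 1) ^ q * (1/2) ^ (j div 2))" for j
  proof -
    have "{T \<in> D. weight2 T - M = j} = {T \<in> D. weight2 T = M + j}" using M by force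
    then have "(\<Sum>T\<in>{T \<in> D. weight2 T - M = j}. (1/2::real) ^ weight2 T) = card {T \<in> D. weight2 T = M + j} * (1/2) ^ (M + j)"
      by simp
    also have "\<dots> \<le> real ((M + j + 1) ^ q * 2 ^ ((j + 1) div 2)) * (1/2) ^ (M + j)"
      using card_weight2_eq_le[OF D, of j] unfolding q_def by (intro mult_right_mono of_nat_mono) auto
    also have "\<dots> = (1/2) ^ M * real (M + j + 1) ^ q * (2 ^ ((j + 1) div 2) * (1/2) ^ j)"
      by (simp add: power_add)
    also have "(2::real) ^ ((j + 1) div 2) * (1/2) ^ j = (1/2) ^ (j div 2)"
    proof -
      have "j = (j + 1) div 2 + j div 2" by linarith
      then have "(1/2::real) ^ j = (1/2) ^ ((j + 1) div 2) * (1/2) ^ (j div 2)" by (metis power_add)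
      then show ?thesis by (simp add: power_one_over)
    qed
    also have "(1/2) ^ M * real (M + j + 1) ^ q * (1/2) ^ (j div 2)
        \<le> (1/2) ^ M * ((real M + 1) * (real j + 1)) ^ q * (1/2) ^ (j div 2)"
      by (intro mult_right_mono mult_left_mono power_mono) (auto simp: algebra_simps)
    finally show ?thesis by (simp add: K_def power_mult_distrib mult_ac)
  qed
  have "(\<Sum>T\<in>D. (1/2::real) ^ weight2 T)
      = (\<Sum>j\<in>(\<lambda>T. weight2 T - M) ` D. \<Sum>T\<in>{T \<in> D. weight2 T - M = j}. (1/2) ^ weight2 T)"
    by (rule sum.image_gen[OF fin])
  also have "\<dots> \<le> K * (\<Sum>j\<in>(\<lambda>T. weight2 T - M) ` D. (real j + 1) ^ q * (1/2) ^ (j div 2))"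
    unfolding sum_distrib_left by (intro sum_mono level)
  also have "\<dots> \<le> K * separated_const q"
    unfolding separated_const_def K_def using fin
    by (intro mult_left_mono sum_le_suminf[OF summable_poly_half_power]) auto
  finally show ?thesis by (simp add: K_def mult.commute)
qed

section \<open>A smooth convex ramp\<close>

definition derivative_sequence :: "(nat \<Rightarrow> real \<Rightarrow> real) \<Rightarrow> bool" where
  "derivative_sequence D \<longleftrightarrow> (\<forall>n u. (D n has_real_derivative D (Suc n) u) (at u))"

lemma derivative_sequenceD: "derivative_sequence D \<Longrightarrow> (D n has_real_derivative D (Suc n) u) (at u)"
  by (simp add: derivative_sequence_def)

lemma continuous_on_of_DERIV:
  fixes f :: "real \<Rightarrow> real"
  assumes "\<And>u. (f has_real_derivative f' u) (at u)"
  shows "continuous_on S f"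
  by (rule DERIV_continuous_on) (use assms has_field_derivative_at_within in blast)

lemma mono_of_DERIV_nonneg:
  fixes f :: "real \<Rightarrow> real"
  assumes "\<And>u. (f has_real_derivative f' u) (at u)" "\<And>u. 0 \<le> f' u"
  shows "mono f"
  by (rule monoI, rule DERIV_nonneg_imp_nondecreasing) (use assms in blast)+

lemma continuous_on_derivative_sequence: "derivative_sequence D \<Longrightarrow> continuous_on S (D n)"
  by (rule continuous_on_of_DERIV) (rule derivative_sequenceD)

lemma derivative_sequence_shift: "derivative_sequence D \<Longrightarrow> derivative_sequence (\<lambda>n. D (n + m))"
  by (simp add: derivative_sequence_def)

lemma derivative_sequence_add:
  "derivative_sequence D \<Longrightarrow> derivative_sequence E \<Longrightarrow> derivative_sequence (\<lambda>n u. D n u + E n u)"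
  by (auto simp: derivative_sequence_def intro: DERIV_add)

lemma derivative_sequence_diff:
  "derivative_sequence D \<Longrightarrow> derivative_sequence E \<Longrightarrow> derivative_sequence (\<lambda>n u. D n u - E n u)"
  by (auto simp: derivative_sequence_def intro: DERIV_diff)

lemma derivative_sequence_cmult: "derivative_sequence D \<Longrightarrow> derivative_sequence (\<lambda>n u. c * D n u)"
  by (auto simp: derivative_sequence_def intro: DERIV_cmult)

lemma derivative_sequence_affine:
  assumes "derivative_sequence D"
  shows "derivative_sequence (\<lambda>n u. a ^ n * D n (a * u + b))"
  unfolding derivative_sequence_def
proof (intro allI)
  fix n u
  have "((\<lambda>u. D n (a * u + b)) has_real_derivative D (Suc n) (a * u + b) * a) (at u)"
    by (rule DERIV_comp_affine) (rule derivative_sequenceD[OF assms])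
  from DERIV_cmult[OF this, of "a ^ n"]
  show "((\<lambda>u. a ^ n * D n (a * u + b)) has_real_derivative a ^ Suc n * D (Suc n) (a * u + b)) (at u)"
    by (simp add: mult_ac)
qed

lemma derivative_sequence_case_nat:
  assumes "derivative_sequence D" "\<And>u. (F has_real_derivative D 0 u) (at u)"
  shows "derivative_sequence (case_nat F D)"
  using assms by (auto simp: derivative_sequence_def split: nat.split)

lemma derivative_sequence_mult:
  assumes D: "derivative_sequence D" and E: "derivative_sequence E"
  shows "derivative_sequence (\<lambda>n u. \<Sum>k\<le>n. real (n choose k) * D k u * E (n - k) u)"
  unfolding derivative_sequence_def
proof (intro allI)
  fix n u
  define a where "a k = D (Suc k) u * E (n - k) u" for k
  define b where "b k = D k u * E (Suc n - k) u" for k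
  have "((\<lambda>u. \<Sum>k\<le>n. real (n choose k) * D k u * E (n - k) u) has_real_derivative
      (\<Sum>k\<le>n. real (n choose k) * (a k + b k))) (at u)"
  proof (rule DERIV_sum)
    fix k assume "k \<in> {..n}"
    then have "((\<lambda>u. D k u * E (n - k) u) has_real_derivative a k + b k) (at u)"
      using DERIV_mult[OF derivative_sequenceD[OF D, of k u] derivative_sequenceD[OF E, of "n - k" u]]
      by (simp add: a_def b_def Suc_diff_le mult.commute)
    then show "((\<lambda>u. real (n choose k) * D k u * E (n - k) u) has_real_derivative real (n choose k) * (a k + b k)) (at u)"
      unfolding mult.assoc by (rule DERIV_cmult)
  qed
  also have "(\<Sum>k\<le>n. real (n choose k) * (a k + b k)) = (\<Sum>k\<le>Suc n. real (Suc n choose k) * b k)"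
  proof -
    have "(\<Sum>k\<le>Suc n. real (Suc n choose k) * b k) = b 0 + (\<Sum>k\<le>n. real (n choose k) * a k) + (\<Sum>k\<le>n. real (n choose Suc k) * b (Suc k))"
      by (subst sum.atMost_Suc_shift) (simp add: a_def b_def distrib_right sum.distrib)
    also have "(\<Sum>k\<le>n. real (n choose Suc k) * b (Suc k)) + b 0 = (\<Sum>k\<le>n. real (n choose k) * b k)"
      using sum.atMost_Suc_shift[of "\<lambda>k. real (n choose k) * b k" n] by (simp add: binomial_eq_0)
    then have "b 0 + (\<Sum>k\<le>n. real (n choose k) * a k) + (\<Sum>k\<le>n. real (n choose Suc k) * b (Suc k))
        = (\<Sum>k\<le>n. real (n choose k) * a k) + (\<Sum>k\<le>n. real (n choose k) * b k)"
      by simp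
    finally show ?thesis by (simp add: distrib_left sum.distrib)
  qed
  finally show "((\<lambda>u. \<Sum>k\<le>n. real (n choose k) * D k u * E (n - k) u) has_real_derivative
      (\<Sum>k\<le>Suc n. real (Suc n choose k) * D k u * E (Suc n - k) u)) (at u)"
    by (simp only: b_def mult.assoc)
qed

lemma DERIV_zero_if_quadratic:
  fixes f :: "real \<Rightarrow> real"
  assumes "\<And>u. \<bar>f u\<bar> \<le> C * (u - a)\<^sup>2"
  shows "(f has_real_derivative 0) (at a)"
proof -
  have "f a = 0" using assms[of a] by simp
  have "((\<lambda>y. (f y - f a) / (y - a)) \<longlongrightarrow> 0) (at a)"
  proof (rule Lim_null_comparison)
    show "\<forall>\<^sub>F y in at a. norm ((f y - f a) / (y - a)) \<le> C * \<bar>y - a\<bar>"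
      unfolding eventually_at_filter
    proof (rule always_eventually, intro allI impI)
      fix y assume "y \<noteq> a"
      moreover have "\<bar>f y\<bar> \<le> (C * \<bar>y - a\<bar>) * \<bar>y - a\<bar>" using assms[of y] by (simp add: power2_eq_square)
      ultimately show "norm ((f y - f a) / (y - a)) \<le> C * \<bar>y - a\<bar>"
        by (simp add: \<open>f a = 0\<close> divide_le_eq)
    qed
    show "((\<lambda>y. C * \<bar>y - a\<bar>) \<longlongrightarrow> 0) (at a)" by (rule tendsto_eq_intros refl | simp)+
  qed
  then show ?thesis by (simp add: has_field_derivative_iff)
qed

text \<open>The family \<open>p(1/u) exp(-1/u)\<close> on \<open>(0, \<infinity>)\<close>, extended by 0, is closed under differentiation.\<close>

definition exp_inv :: "real poly \<Rightarrow> real \<Rightarrow> real" where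
  "exp_inv p u = (if u > 0 then poly p (1/u) * exp (- (1/u)) else 0)"

definition exp_inv_deriv :: "real poly \<Rightarrow> real poly" where
  "exp_inv_deriv p = [:0, 0, 1:] * (p - pderiv p)"

lemma power_le_fact_exp:
  fixes x :: real
  assumes "x \<ge> 0"
  shows "x ^ m \<le> fact m * exp x"
proof -
  have "x ^ m /\<^sub>R fact m \<le> (\<Sum>n. x ^ n /\<^sub>R fact n)"
    using sum_le_suminf[OF summable_exp_generic[of x], of "{m}"] assms by auto
  then have "x ^ m / fact m \<le> exp x" by (simp add: exp_def field_simps)
  then show ?thesis by (simp add: field_simps)
qed

lemma abs_poly_le_exp:
  fixes p :: "real poly"
  obtains C where "\<And>x. x \<ge> 0 \<Longrightarrow> \<bar>poly p x\<bar> \<le> C * exp x"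
proof
  fix x :: real assume x: "x \<ge> 0"
  have "\<bar>poly p x\<bar> \<le> (\<Sum>i\<le>degree p. \<bar>coeff p i * x ^ i\<bar>)"
    unfolding poly_altdef by (rule sum_abs)
  also have "\<dots> \<le> (\<Sum>i\<le>degree p. \<bar>coeff p i\<bar> * (fact i * exp x))"
    using x by (intro sum_mono) (simp add: abs_mult mult_left_mono power_le_fact_exp)
  finally show "\<bar>poly p x\<bar> \<le> (\<Sum>i\<le>degree p. \<bar>coeff p i\<bar> * fact i) * exp x"
    by (simp add: sum_distrib_right mult.assoc)
qed

lemma abs_exp_inv_le_quadratic:
  obtains C where "\<And>u. \<bar>exp_inv p u\<bar> \<le> C * u\<^sup>2"
proof -
  obtain C where C: "\<And>x. x \<ge> 0 \<Longrightarrow> \<bar>poly ([:0, 0, 1:] * p) x\<bar> \<le> C * exp x"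
    using abs_poly_le_exp by blast
  have "\<bar>exp_inv p u\<bar> \<le> C * u\<^sup>2" for u
  proof (cases "u > 0")
    case True
    then have "\<bar>poly p (1/u)\<bar> / u\<^sup>2 \<le> C * exp (1/u)"
      using C[of "1/u"] by (simp add: abs_mult power2_eq_square)
    then show ?thesis using True by (simp add: exp_inv_def abs_mult exp_minus field_simps)
  next
    case False
    have "0 \<le> C" using order_trans[OF abs_ge_zero C[of 0]] by simp
    then show ?thesis using False by (simp add: exp_inv_def)
  qed
  then show thesis by (rule that)
qed

lemma DERIV_exp_inv: "(exp_inv p has_real_derivative exp_inv (exp_inv_deriv p) u) (at u)"
proof -
  consider "u > 0" | "u < 0" | "u = 0" by linarith
  then show ?thesis
  proof cases
    case 1
    have inv: "((\<lambda>u. 1/u) has_real_derivative - (1 / u\<^sup>2)) (at u)"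
      using 1 by (auto intro!: derivative_eq_intros simp: power2_eq_square)
    from DERIV_mult[OF DERIV_chain2[OF poly_DERIV inv] DERIV_fun_exp[OF DERIV_minus[OF inv]], of p]
    have "((\<lambda>u. poly p (1/u) * exp (- (1/u))) has_real_derivative exp_inv (exp_inv_deriv p) u) (at u)"
      using 1 by (simp add: exp_inv_def exp_inv_deriv_def power2_eq_square algebra_simps)
    then show ?thesis
      by (rule has_field_derivative_transform_within_open[of _ _ _ "{0<..}"]) (use 1 in \<open>auto simp: exp_inv_def\<close>)
  next
    case 2
    have "((\<lambda>_. 0) has_real_derivative exp_inv (exp_inv_deriv p) u) (at u)"
      using 2 by (simp add: exp_inv_def)
    then show ?thesis
      by (rule has_field_derivative_transform_within_open[of _ _ _ "{..<0}"]) (use 2 in \<open>auto simp: exp_inv_def\<close>)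
  next
    case 3
    obtain C where "\<And>u. \<bar>exp_inv p u\<bar> \<le> C * u\<^sup>2" using abs_exp_inv_le_quadratic by blast
    then show ?thesis using DERIV_zero_if_quadratic[of "exp_inv p" C 0] 3 by (simp add: exp_inv_def)
  qed
qed

definition exp_inv_seq :: "nat \<Rightarrow> real \<Rightarrow> real" where
  "exp_inv_seq n = exp_inv ((exp_inv_deriv ^^ n) 1)"

definition bump :: "nat \<Rightarrow> real \<Rightarrow> real" where
  "bump n u = (\<Sum>k\<le>n. real (n choose k) * exp_inv_seq k (1 + u) * ((-1) ^ (n - k) * exp_inv_seq (n - k) (1 - u)))"

definition bump_step :: "real \<Rightarrow> real" where
  "bump_step u = integral {-1..u} (bump 0)"

definition bump_ramp :: "real \<Rightarrow> real" where
  "bump_ramp u = integral {-1..u} bump_step"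

text \<open>\<open>ramp n\<close> is the \<open>n\<close>-th derivative of a smooth convex version of the positive part \<open>max u 0\<close>.\<close>

definition ramp :: "nat \<Rightarrow> real \<Rightarrow> real" where
  "ramp n u = 1 / bump_step 1 * case_nat bump_ramp (case_nat bump_step bump) n u"

lemma derivative_sequence_bump: "derivative_sequence bump"
proof -
  have "derivative_sequence exp_inv_seq"
    by (simp add: derivative_sequence_def exp_inv_seq_def DERIV_exp_inv)
  from derivative_sequence_mult[OF derivative_sequence_affine[OF this, of 1 1] derivative_sequence_affine[OF this, of "-1" 1]]
  show ?thesis by (simp add: bump_def[abs_def] add.commute)
qed

lemma bump_0: "bump 0 u = exp_inv_seq 0 (1 + u) * exp_inv_seq 0 (1 - u)"
  by (simp add: bump_def)

lemma bump_0_nonneg: "bump 0 u \<ge> 0"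
  by (simp add: bump_0 exp_inv_seq_def exp_inv_def)

lemma bump_0_eq_0: "\<bar>u\<bar> \<ge> 1 \<Longrightarrow> bump 0 u = 0"
  by (auto simp: bump_0 exp_inv_seq_def exp_inv_def abs_if split: if_splits)

lemma bump_0_at_0_pos: "bump 0 0 > 0"
  by (simp add: bump_0 exp_inv_seq_def exp_inv_def)

lemma bump_0_even: "bump 0 (- u) = bump 0 u"
  by (simp add: bump_0 mult.commute)

lemma DERIV_integral_from_left:
  fixes g :: "real \<Rightarrow> real"
  assumes cont: "continuous_on UNIV g" and zero: "\<And>u. u \<le> a \<Longrightarrow> g u = 0"
  shows "((\<lambda>u. integral {a..u} g) has_real_derivative g u) (at u)"
proof -
  define c where "c = min a u - 1"
  have "c \<le> x" "a \<le> x" if "g x \<noteq> 0" for x using zero[of x] that unfolding c_def by linarith+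
  then have "integral {a..v} g = integral {c..v} g" for v
    by (intro integral_spike_set empty_imp_negligible) auto
  moreover have "((\<lambda>v. integral {c..v} g) has_real_derivative g u) (at u within {c..u+1})"
    using cont by (intro integral_has_real_derivative) (auto intro: continuous_on_subset simp: c_def)
  moreover have "at u within {c..u+1} = at u"
    by (rule at_within_interior) (auto simp: c_def)
  ultimately show ?thesis by simp
qed

lemma bump_step_eq_0: "u \<le> -1 \<Longrightarrow> bump_step u = 0"
  by (cases "u = -1") (auto simp: bump_step_def)

lemma bump_ramp_eq_0: "u \<le> -1 \<Longrightarrow> bump_ramp u = 0"
  by (cases "u = -1") (auto simp: bump_ramp_def)

lemma DERIV_bump_step: "(bump_step has_real_derivative bump 0 u) (at u)"
  unfolding bump_step_def[abs_def]
  by (rule DERIV_integral_from_left) (auto simp: bump_0_eq_0 continuous_on_derivative_sequence derivative_sequence_bump)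

lemma DERIV_bump_ramp: "(bump_ramp has_real_derivative bump_step u) (at u)"
  unfolding bump_ramp_def[abs_def]
  by (rule DERIV_integral_from_left) (auto simp: bump_step_eq_0 intro: continuous_on_of_DERIV DERIV_bump_step)

lemma bump_step_pos: "bump_step 1 > 0"
proof -
  have cont: "continuous_on {-1..1} (bump 0)"
    by (rule continuous_on_derivative_sequence[OF derivative_sequence_bump])
  have "bump_step 1 \<noteq> 0"
    using integral_eq_0_iff[OF cont _ bump_0_nonneg] bump_0_at_0_pos by (auto simp: bump_step_def)
  moreover have "bump_step 1 \<ge> 0"
    using cont bump_0_nonneg unfolding bump_step_def by (intro integral_nonneg integrable_continuous_interval)
  ultimately show ?thesis by simp
qed

lemma bump_step_add_reflect: "bump_step u + bump_step (- u) = bump_step 1"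
proof -
  have "((\<lambda>u. bump_step u + bump_step (- u)) has_real_derivative 0) (at u)" for u
  proof -
    have "((\<lambda>u. bump_step (- u)) has_real_derivative - bump 0 (- u)) (at u)"
      using DERIV_comp_affine[OF DERIV_bump_step, of "-1" 0 u] by simp
    from DERIV_add[OF DERIV_bump_step[of u] this] show ?thesis by (simp add: bump_0_even)
  qed
  from DERIV_isconst_all[OF allI, OF this, of u 1] show ?thesis by (simp add: bump_step_eq_0)
qed

lemma bump_ramp_diff_reflect: "bump_ramp u - bump_ramp (- u) = bump_step 1 * u"
proof -
  have "((\<lambda>u. bump_ramp u - bump_ramp (- u) - bump_step 1 * u) has_real_derivative 0) (at u)" for u
  proof -
    have "((\<lambda>u. bump_ramp (- u)) has_real_derivative - bump_step (- u)) (at u)"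
      using DERIV_comp_affine[OF DERIV_bump_ramp, of "-1" 0 u] by simp
    from DERIV_diff[OF DERIV_diff[OF DERIV_bump_ramp[of u] this] DERIV_cmult[OF DERIV_ident, of "bump_step 1"]]
    show ?thesis using bump_step_add_reflect[of u] by simp
  qed
  from DERIV_isconst_all[OF allI, OF this, of u 0] show ?thesis by simp
qed

lemma derivative_sequence_ramp: "derivative_sequence ramp"
  unfolding ramp_def[abs_def]
  by (intro derivative_sequence_cmult derivative_sequence_case_nat derivative_sequence_bump)
    (auto simp: DERIV_bump_ramp DERIV_bump_step)

lemma ramp_0_left: "u \<le> -1 \<Longrightarrow> ramp 0 u = 0"
  by (simp add: ramp_def bump_ramp_eq_0)

lemma ramp_0_right: "u \<ge> 1 \<Longrightarrow> ramp 0 u = u"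
  using bump_ramp_diff_reflect[of u] bump_step_pos by (simp add: ramp_def bump_ramp_eq_0)

lemma ramp_1_left: "u \<le> -1 \<Longrightarrow> ramp 1 u = 0"
  by (simp add: ramp_def bump_step_eq_0)

lemma ramp_1_right: "u \<ge> 1 \<Longrightarrow> ramp 1 u = 1"
  using bump_step_add_reflect[of u] bump_step_pos by (simp add: ramp_def bump_step_eq_0)

lemma ramp_2_nonneg: "ramp 2 u \<ge> 0"
  using bump_step_pos by (simp add: ramp_def bump_0_nonneg numeral_2_eq_2)

lemma ramp_2_eq_0: "\<bar>u\<bar> \<ge> 1 \<Longrightarrow> ramp 2 u = 0"
  by (simp add: ramp_def bump_0_eq_0 numeral_2_eq_2)

definition scaled_ramp :: "real \<Rightarrow> nat \<Rightarrow> real \<Rightarrow> real" where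
  "scaled_ramp \<epsilon> n u = \<epsilon> * (1/\<epsilon>) ^ n * ramp n (u/\<epsilon>)"

lemma derivative_sequence_scaled_ramp: "derivative_sequence (scaled_ramp \<epsilon>)"
  using derivative_sequence_cmult[OF derivative_sequence_affine[OF derivative_sequence_ramp, of "1/\<epsilon>" 0], of \<epsilon>]
  by (simp add: scaled_ramp_def[abs_def] mult.assoc)

lemma derivative_sequence_scaled_ramp_shift: "derivative_sequence (\<lambda>n s. scaled_ramp \<epsilon> n (s - c))"
  using derivative_sequence_affine[OF derivative_sequence_scaled_ramp[of \<epsilon>], of 1 "- c"] by simp

lemma continuous_on_scaled_ramp_shift: "continuous_on S (\<lambda>s. scaled_ramp \<epsilon> n (s - c))"
  by (rule continuous_on_derivative_sequence[OF derivative_sequence_scaled_ramp_shift])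

context
  fixes \<epsilon> :: real
  assumes eps: "\<epsilon> > 0"
begin

lemma scaled_ramp_0_left: "u \<le> - \<epsilon> \<Longrightarrow> scaled_ramp \<epsilon> 0 u = 0"
  using eps by (simp add: scaled_ramp_def ramp_0_left divide_le_eq)

lemma scaled_ramp_0_right: "u \<ge> \<epsilon> \<Longrightarrow> scaled_ramp \<epsilon> 0 u = u"
  using eps by (simp add: scaled_ramp_def ramp_0_right)

lemma scaled_ramp_1_left: "u \<le> - \<epsilon> \<Longrightarrow> scaled_ramp \<epsilon> 1 u = 0"
  using eps by (simp add: scaled_ramp_def ramp_1_left[unfolded One_nat_def] divide_le_eq)

lemma scaled_ramp_1_right: "u \<ge> \<epsilon> \<Longrightarrow> scaled_ramp \<epsilon> 1 u = 1"
  using eps by (simp add: scaled_ramp_def ramp_1_right[unfolded One_nat_def])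

lemma scaled_ramp_2_nonneg: "0 \<le> scaled_ramp \<epsilon> 2 u"
  using eps ramp_2_nonneg by (simp add: scaled_ramp_def)

lemma scaled_ramp_2_eq_0: "\<bar>u\<bar> \<ge> \<epsilon> \<Longrightarrow> scaled_ramp \<epsilon> 2 u = 0"
  using eps by (simp add: scaled_ramp_def ramp_2_eq_0 abs_divide)

lemma scaled_ramp_1_mono: "mono (scaled_ramp \<epsilon> 1)"
proof (rule mono_of_DERIV_nonneg)
  show "(scaled_ramp \<epsilon> 1 has_real_derivative scaled_ramp \<epsilon> 2 u) (at u)" for u
    using derivative_sequenceD[OF derivative_sequence_scaled_ramp, of \<epsilon> 1] by (simp add: numeral_2_eq_2)
qed (rule scaled_ramp_2_nonneg)

lemma scaled_ramp_1_bounds: "0 \<le> scaled_ramp \<epsilon> 1 u" "scaled_ramp \<epsilon> 1 u \<le> 1"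
proof -
  have "scaled_ramp \<epsilon> 1 (min u (- \<epsilon>)) \<le> scaled_ramp \<epsilon> 1 u" by (rule monoD[OF scaled_ramp_1_mono]) simp
  then show "0 \<le> scaled_ramp \<epsilon> 1 u" by (simp only: scaled_ramp_1_left min.cobounded2)
  have "scaled_ramp \<epsilon> 1 u \<le> scaled_ramp \<epsilon> 1 (max u \<epsilon>)" by (rule monoD[OF scaled_ramp_1_mono]) simp
  then show "scaled_ramp \<epsilon> 1 u \<le> 1" by (simp only: scaled_ramp_1_right max.cobounded2)
qed

lemma scaled_ramp_0_bounds: "0 \<le> scaled_ramp \<epsilon> 0 u" "scaled_ramp \<epsilon> 0 u \<le> \<bar>u\<bar> + \<epsilon>"
proof -
  have mono: "mono (scaled_ramp \<epsilon> 0)"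
    using derivative_sequenceD[OF derivative_sequence_scaled_ramp, of \<epsilon> 0] scaled_ramp_1_bounds(1)
    by (intro mono_of_DERIV_nonneg) auto
  have "scaled_ramp \<epsilon> 0 (min u (- \<epsilon>)) \<le> scaled_ramp \<epsilon> 0 u" by (rule monoD[OF mono]) simp
  then show "0 \<le> scaled_ramp \<epsilon> 0 u" by (simp only: scaled_ramp_0_left min.cobounded2)
  have "scaled_ramp \<epsilon> 0 u \<le> scaled_ramp \<epsilon> 0 (\<bar>u\<bar> + \<epsilon>)" using eps by (intro monoD[OF mono]) simp
  then show "scaled_ramp \<epsilon> 0 u \<le> \<bar>u\<bar> + \<epsilon>" by (simp only: scaled_ramp_0_right le_add_same_cancel2 abs_ge_zero)
qed

lemma nn_integral_scaled_ramp_2: "(\<integral>\<^sup>+ s. ennreal (scaled_ramp \<epsilon> 2 (s - x)) \<partial>lborel) = 1"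
proof -
  have "((\<lambda>s. scaled_ramp \<epsilon> 1 (s - x)) has_real_derivative scaled_ramp \<epsilon> 2 (s - x)) (at s)" for s
    using derivative_sequenceD[OF derivative_sequence_scaled_ramp_shift, of \<epsilon> 1] by (simp add: numeral_2_eq_2)
  then have "((\<lambda>s. scaled_ramp \<epsilon> 2 (s - x)) has_integral
      (scaled_ramp \<epsilon> 1 (x + \<epsilon> - x) - scaled_ramp \<epsilon> 1 (x - \<epsilon> - x))) {x - \<epsilon>..x + \<epsilon>}"
    using eps by (intro fundamental_theorem_of_calculus)
      (auto simp flip: has_real_derivative_iff_has_vector_derivative intro: has_field_derivative_at_within)
  moreover have "scaled_ramp \<epsilon> 1 (x + \<epsilon> - x) = 1" "scaled_ramp \<epsilon> 1 (x - \<epsilon> - x) = 0"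
    by (simp_all add: scaled_ramp_1_left scaled_ramp_1_right del: One_nat_def)
  ultimately have "((\<lambda>s. scaled_ramp \<epsilon> 2 (s - x)) has_integral 1) {x - \<epsilon>..x + \<epsilon>}"
    by (simp only: diff_zero)
  then have "((\<lambda>s. scaled_ramp \<epsilon> 2 (s - x)) has_integral 1) UNIV"
    by (rule has_integral_on_superset) (auto intro!: scaled_ramp_2_eq_0)
  then have "(\<integral>\<^sup>+ s. ennreal (scaled_ramp \<epsilon> 2 (s - x)) \<partial>lborel) = ennreal 1"
    by (intro nn_integral_has_integral_lborel borel_measurable_continuous_onI scaled_ramp_2_nonneg
        continuous_on_scaled_ramp_shift)
  then show ?thesis by simp
qed

end

section \<open>Representation by weak derivatives\<close>

lemma mem_unit_cube: "s \<in> unit_cube \<longleftrightarrow> (\<forall>i. 0 \<le> s $ i \<and> s $ i \<le> 1)"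
  by (auto simp: unit_cube_def mem_box_cart)

lemma prod_Basis_vec:
  "(\<Prod>b\<in>(Basis :: (real^'d::finite) set). F b) = (\<Prod>i\<in>UNIV. F (axis i 1))"
proof -
  have Basis_eq: "(Basis :: (real^'d) set) = (\<lambda>i. axis i 1) ` UNIV" by (auto simp: Basis_vec_def)
  show ?thesis unfolding Basis_eq by (subst prod.reindex) (auto simp: inj_on_def axis_eq_axis)
qed

lemma integrable_continuous_unit_cube:
  "continuous_on unit_cube k \<Longrightarrow> integrable (lebesgue_on unit_cube) k"
  for k :: "real^'d::finite \<Rightarrow> real"
  unfolding unit_cube_def by (rule continuous_imp_integrable)

lemma continuous_on_unit_cube_bounded:
  fixes k :: "real^'d::finite \<Rightarrow> real"
  assumes "continuous_on unit_cube k"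
  obtains B where "\<And>s. s \<in> unit_cube \<Longrightarrow> \<bar>k s\<bar> \<le> B"
proof -
  have "bounded (k ` unit_cube)"
    using assms by (intro compact_imp_bounded compact_continuous_image) (simp_all add: unit_cube_def)
  then show thesis using that unfolding bounded_iff by auto
qed

lemma continuous_on_prod_coords:
  fixes h :: "'d::finite \<Rightarrow> real \<Rightarrow> real"
  assumes "\<And>i. continuous_on UNIV (h i)"
  shows "continuous_on S (\<lambda>x :: real^'d. \<Prod>i\<in>UNIV. h i (x $ i))"
  by (intro continuous_on_prod continuous_on_compose2[OF assms] continuous_intros) auto

lemma finite_pos_lower_bound:
  fixes c :: "'d::finite \<Rightarrow> real"
  assumes "\<And>i. c i > 0"
  obtains a where "a > 0" "\<And>i. a \<le> c i"
  using assms by (intro that[of "Min (range c)"]) auto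

lemma DERIV_prod_coords:
  fixes D :: "'d::finite \<Rightarrow> nat \<Rightarrow> real \<Rightarrow> real"
  assumes D: "\<And>i. derivative_sequence (D i)"
  shows "((\<lambda>s. \<Prod>i\<in>UNIV. D i (m i) ((x + s *\<^sub>R axis j 1) $ i)) has_real_derivative
     (\<Prod>i\<in>UNIV. D i ((m(j := Suc (m j))) i) (x $ i))) (at 0)"
proof -
  have "(\<Prod>i\<in>UNIV. D i (m i) ((x + s *\<^sub>R axis j 1) $ i))
      = D j (m j) (x $ j + s) * (\<Prod>i\<in>UNIV - {j}. D i (m i) (x $ i))" for s
    by (subst prod.remove[of UNIV j]) (auto simp: axis_def intro!: prod.cong)
  moreover have "((\<lambda>s. D j (m j) (x $ j + s)) has_real_derivative D j (Suc (m j)) (x $ j)) (at 0)"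
    using DERIV_comp_affine[OF derivative_sequenceD[OF D], of j "m j" 1 "x $ j" 0] by (simp add: add.commute)
  note DERIV_cmult_right[OF this, of "\<Prod>i\<in>UNIV - {j}. D i (m i) (x $ i)"]
  moreover have "(\<Prod>i\<in>UNIV. D i ((m(j := Suc (m j))) i) (x $ i))
      = D j (Suc (m j)) (x $ j) * (\<Prod>i\<in>UNIV - {j}. D i (m i) (x $ i))"
    by (subst prod.remove[of UNIV j]) (auto intro!: prod.cong)
  ultimately show ?thesis by simp
qed

lemma iter_pd_prod:
  fixes D :: "'d::finite \<Rightarrow> nat \<Rightarrow> real \<Rightarrow> real"
  assumes D: "\<And>i. derivative_sequence (D i)"
  shows "iter_pd is (\<lambda>x. \<Prod>i\<in>UNIV. D i 0 (x $ i)) = (\<lambda>x. \<Prod>i\<in>UNIV. D i (count (mset is) i) (x $ i))"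
proof (induction "is")
  case Nil
  then show ?case by simp
next
  case (Cons j "is")
  have "(count (mset is))(j := Suc (count (mset is) j)) = count (mset (j # is))" by auto
  then show ?case
    using DERIV_imp_deriv[OF DERIV_prod_coords[where D = D, OF D, of "count (mset is)" _ j]]
    by (simp add: Cons pd_def fun_eq_iff)
qed

lemma test_fn_prod:
  fixes D :: "'d::finite \<Rightarrow> nat \<Rightarrow> real \<Rightarrow> real"
  assumes D: "\<And>i. derivative_sequence (D i)"
    and a: "a > 0" and supp: "\<And>i u. u \<le> a \<or> 1 - a \<le> u \<Longrightarrow> D i 0 u = 0"
  shows "test_fn (\<lambda>x. \<Prod>i\<in>UNIV. D i 0 (x $ i))"
  unfolding test_fn_def
proof (intro conjI allI exI)
  fix "is" :: "'d list"
  show "continuous_on UNIV (iter_pd is (\<lambda>x. \<Prod>i\<in>UNIV. D i 0 (x $ i)))"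
    unfolding iter_pd_prod[where D = D, OF D]
    by (intro continuous_on_prod_coords continuous_on_derivative_sequence D)
  show "(\<lambda>s. iter_pd is (\<lambda>x. \<Prod>i\<in>UNIV. D i 0 (x $ i)) (x + s *\<^sub>R axis j 1)) field_differentiable at 0" for j x
    unfolding iter_pd_prod[where D = D, OF D] field_differentiable_def
    using DERIV_prod_coords[where D = D, OF D] by blast
next
  let ?K = "cbox (\<chi> i. a) (\<chi> i. 1 - a) :: (real^'d) set"
  show "compact ?K" by simp
  show "?K \<subseteq> box 0 1"
  proof
    fix x assume "x \<in> ?K"
    then have "a \<le> x $ i" "x $ i \<le> 1 - a" for i by (auto simp: mem_box_cart)
    then have "0 < x $ i \<and> x $ i < 1" for i using a by (smt (verit))
    then show "x \<in> box 0 1" by (simp add: mem_box_cart)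
  qed
  fix x :: "real^'d"
  show "x \<notin> ?K \<longrightarrow> (\<Prod>i\<in>UNIV. D i 0 (x $ i)) = 0"
  proof
    assume "x \<notin> ?K"
    then obtain i where "x $ i < a \<or> 1 - a < x $ i" by (auto simp: mem_box_cart not_le)
    then have "D i 0 (x $ i) = 0" using supp by auto
    then show "(\<Prod>i\<in>UNIV. D i 0 (x $ i)) = 0" by (auto intro!: prod_zero)
  qed
qed

definition mollifier :: "real \<Rightarrow> real^'d::finite \<Rightarrow> real^'d \<Rightarrow> real" where
  "mollifier \<epsilon> x s = (\<Prod>i\<in>UNIV. scaled_ramp \<epsilon> 2 (s $ i - x $ i))"

lemma continuous_on_mollifier: "continuous_on S (mollifier \<epsilon> x)"
  unfolding mollifier_def by (intro continuous_on_prod_coords continuous_on_scaled_ramp_shift)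

lemma mollifier_nonneg: "\<epsilon> > 0 \<Longrightarrow> mollifier \<epsilon> x s \<ge> 0"
  unfolding mollifier_def by (intro prod_nonneg scaled_ramp_2_nonneg) auto

lemma mollifier_eq_0: "\<epsilon> > 0 \<Longrightarrow> \<bar>s $ i - x $ i\<bar> \<ge> \<epsilon> \<Longrightarrow> mollifier \<epsilon> x s = 0"
  unfolding mollifier_def by (intro prod_zero) (auto intro: scaled_ramp_2_eq_0)

lemma nn_integral_mollifier:
  assumes eps: "\<epsilon> > 0"
  shows "(\<integral>\<^sup>+ s. ennreal (mollifier \<epsilon> x s) \<partial>lborel) = 1"
proof -
  have "(\<integral>\<^sup>+ s. ennreal (mollifier \<epsilon> x s) \<partial>lborel)
      = (\<integral>\<^sup>+ s. (\<Prod>b\<in>Basis. ennreal (scaled_ramp \<epsilon> 2 (s \<bullet> b - x \<bullet> b))) \<partial>lborel)"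
    unfolding mollifier_def using scaled_ramp_2_nonneg[OF eps]
    by (simp add: prod_Basis_vec inner_axis prod_ennreal)
  also have "\<dots> = (\<Prod>b\<in>Basis. (\<integral>\<^sup>+ s. ennreal (scaled_ramp \<epsilon> 2 (s - x \<bullet> b)) \<partial>lborel))"
    by (intro nn_integral_lborel_prod measurable_compose[OF _ measurable_ennreal]
        borel_measurable_continuous_onI continuous_on_scaled_ramp_shift) simp
  also have "\<dots> = 1" by (simp add: nn_integral_scaled_ramp_2[OF eps])
  finally show ?thesis .
qed

lemma integral_mollifier:
  assumes eps: "\<epsilon> > 0" and x: "\<And>i. \<epsilon> \<le> x $ i \<and> x $ i \<le> 1 - \<epsilon>"
  shows "(LINT s|lebesgue_on unit_cube. mollifier \<epsilon> x s) = 1"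
proof -
  have out: "mollifier \<epsilon> x s = 0" if "s \<notin> unit_cube" for s
  proof -
    obtain i where "s $ i < 0 \<or> 1 < s $ i" using \<open>s \<notin> unit_cube\<close> by (auto simp: mem_unit_cube not_le)
    then show ?thesis using x[of i] by (intro mollifier_eq_0[OF eps, of _ i]) auto
  qed
  have meas: "mollifier \<epsilon> x \<in> borel_measurable borel"
    by (intro borel_measurable_continuous_onI continuous_on_mollifier)
  have "(LINT s|lebesgue_on unit_cube. mollifier \<epsilon> x s) = (LINT s|lebesgue. indicator unit_cube s *\<^sub>R mollifier \<epsilon> x s)"
    by (rule integral_restrict_space) (simp add: unit_cube_def)
  also have "\<dots> = (LINT s|lebesgue. mollifier \<epsilon> x s)"
    by (rule Bochner_Integration.integral_cong) (auto simp: indicator_def out)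
  also have "\<dots> = (LINT s|lborel. mollifier \<epsilon> x s)"
    using meas by (intro integral_completion) simp
  also have "\<dots> = enn2real (\<integral>\<^sup>+ s. ennreal (mollifier \<epsilon> x s) \<partial>lborel)"
    using meas mollifier_nonneg[OF eps] by (intro integral_eq_nn_integral) auto
  finally show ?thesis by (simp add: nn_integral_mollifier[OF eps])
qed

lemma mollifier_approx:
  fixes f :: "real^'d::finite \<Rightarrow> real"
  assumes f: "continuous_on unit_cube f" and eps: "\<epsilon> > 0" and x: "\<And>i. \<epsilon> \<le> x $ i \<and> x $ i \<le> 1 - \<epsilon>"
    and close: "\<And>s. s \<in> unit_cube \<Longrightarrow> (\<And>i. \<bar>s $ i - x $ i\<bar> < \<epsilon>) \<Longrightarrow> \<bar>f s - f x\<bar> \<le> \<eta>"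
  shows "\<bar>(LINT s|lebesgue_on unit_cube. f s * mollifier \<epsilon> x s) - f x\<bar> \<le> \<eta>"
proof -
  have int: "integrable (lebesgue_on unit_cube) (mollifier \<epsilon> x)"
    "integrable (lebesgue_on unit_cube) (\<lambda>s. f s * mollifier \<epsilon> x s)"
    using f by (intro integrable_continuous_unit_cube continuous_on_mult continuous_on_mollifier)+
  note one = integral_mollifier[OF eps x]
  have le: "\<bar>f s - f x\<bar> * mollifier \<epsilon> x s \<le> \<eta> * mollifier \<epsilon> x s" if "s \<in> unit_cube" for s
  proof (cases "\<forall>i. \<bar>s $ i - x $ i\<bar> < \<epsilon>")
    case True
    then show ?thesis using close[OF that] mollifier_nonneg[OF eps] by (intro mult_right_mono) auto
  next
    case False
    then show ?thesis using mollifier_eq_0[OF eps, of s _ x] by (auto simp: not_less)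
  qed
  have "(LINT s|lebesgue_on unit_cube. f s * mollifier \<epsilon> x s) - f x
      = (LINT s|lebesgue_on unit_cube. f s * mollifier \<epsilon> x s - f x * mollifier \<epsilon> x s)"
    using int one by simp
  also have "\<bar>\<dots>\<bar> \<le> (LINT s|lebesgue_on unit_cube. \<bar>f s * mollifier \<epsilon> x s - f x * mollifier \<epsilon> x s\<bar>)"
    by (rule integral_abs_bound)
  also have "\<dots> \<le> (LINT s|lebesgue_on unit_cube. \<eta> * mollifier \<epsilon> x s)"
  proof (rule integral_mono)
    show "integrable (lebesgue_on unit_cube) (\<lambda>s. \<bar>f s * mollifier \<epsilon> x s - f x * mollifier \<epsilon> x s\<bar>)"
      "integrable (lebesgue_on unit_cube) (\<lambda>s. \<eta> * mollifier \<epsilon> x s)"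
      using int by auto
    show "\<bar>f s * mollifier \<epsilon> x s - f x * mollifier \<epsilon> x s\<bar> \<le> \<eta> * mollifier \<epsilon> x s"
      if "s \<in> space (lebesgue_on unit_cube)" for s
      using le[of s] that mollifier_nonneg[OF eps, of x s] by (simp add: abs_mult flip: left_diff_distrib)
  qed
  also have "\<dots> = \<eta>" by (simp add: one)
  finally show ?thesis .
qed

lemma mollifier_tendsto:
  fixes f :: "real^'d::finite \<Rightarrow> real"
  assumes f: "continuous_on unit_cube f" and x: "x \<in> box 0 1"
  shows "((\<lambda>\<epsilon>. LINT s|lebesgue_on unit_cube. f s * mollifier \<epsilon> x s) \<longlongrightarrow> f x) (at_right 0)"
proof (rule tendstoI)
  fix \<eta> :: real assume \<eta>: "\<eta> > 0"
  have "x \<in> unit_cube" using x box_subset_cbox unfolding unit_cube_def by blast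
  then obtain \<delta> where \<delta>: "\<delta> > 0" "\<And>s. s \<in> unit_cube \<Longrightarrow> dist s x < \<delta> \<Longrightarrow> dist (f s) (f x) < \<eta> / 2"
    using f half_gt_zero[OF \<eta>] unfolding continuous_on_iff by metis
  obtain m where m: "m > 0" "\<And>i. m \<le> min (x $ i) (1 - x $ i)"
    using finite_pos_lower_bound[of "\<lambda>i. min (x $ i) (1 - x $ i)"] x by (auto simp: mem_box_cart)
  have "\<forall>\<^sub>F \<epsilon> in at_right 0. 0 < \<epsilon> \<and> \<epsilon> < min m (\<delta> / CARD('d))"
    using m(1) \<delta>(1) by (intro eventually_at_rightI[of _ "min m (\<delta> / CARD('d))"]) auto
  then show "\<forall>\<^sub>F \<epsilon> in at_right 0. dist (LINT s|lebesgue_on unit_cube. f s * mollifier \<epsilon> x s) (f x) < \<eta>"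
  proof eventually_elim
    case (elim \<epsilon>)
    have "\<bar>(LINT s|lebesgue_on unit_cube. f s * mollifier \<epsilon> x s) - f x\<bar> \<le> \<eta> / 2"
    proof (rule mollifier_approx[OF f])
      show "\<epsilon> \<le> x $ i \<and> x $ i \<le> 1 - \<epsilon>" for i using m(2)[of i] elim by auto
      fix s assume s: "s \<in> unit_cube" and near: "\<And>i. \<bar>s $ i - x $ i\<bar> < \<epsilon>"
      have "dist s x \<le> (\<Sum>i\<in>UNIV. \<bar>(s - x) $ i\<bar>)" unfolding dist_norm by (rule norm_le_l1_cart)
      also have "\<dots> \<le> (\<Sum>i\<in>(UNIV :: 'd set). \<epsilon>)" using near by (intro sum_mono) (simp add: less_imp_le)
      also have "\<dots> < \<delta>" using elim by (simp add: field_simps)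
      finally show "\<bar>f s - f x\<bar> \<le> \<eta> / 2" using \<delta>(2)[OF s] by (simp add: dist_real_def)
    qed (use elim in simp)
    then show ?case using \<eta> by (simp add: dist_real_def)
  qed
qed

text \<open>As a function of \<open>x\<close>, \<open>ramp_interpolant x n s\<close> is the affine interpolant of
  \<open>c \<mapsto> scaled_ramp (1/8) n (s - c)\<close> at the nodes 1/4 and 3/4. For \<open>n = 2\<close> it has, as a function of \<open>s\<close>,
  the same moments of order 0 and 1 as the mollifier centred at \<open>x\<close>; therefore the difference of the two
  has a compactly supported second antiderivative, which is \<open>peano_kernel True \<epsilon> x 0\<close>.\<close>

definition ramp_interpolant :: "real \<Rightarrow> nat \<Rightarrow> real \<Rightarrow> real" where
  "ramp_interpolant x n s =
     (3/2 - 2 * x) * scaled_ramp (1/8) n (s - 1/4) + (2 * x - 1/2) * scaled_ramp (1/8) n (s - 3/4)"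

definition peano_kernel :: "bool \<Rightarrow> real \<Rightarrow> real \<Rightarrow> nat \<Rightarrow> real \<Rightarrow> real" where
  "peano_kernel u \<epsilon> x n s =
     (if u then scaled_ramp \<epsilon> n (s - x) - ramp_interpolant x n s else ramp_interpolant x (n + 2) s)"

definition peano_kernel_bound :: real where
  "peano_kernel_bound = 6 + 4 * (SUP v\<in>{-1..1}. scaled_ramp (1/8) 2 v)"

lemma derivative_sequence_peano_kernel: "derivative_sequence (peano_kernel u \<epsilon> x)"
proof -
  have "derivative_sequence (ramp_interpolant x)"
    unfolding ramp_interpolant_def[abs_def]
    by (intro derivative_sequence_add derivative_sequence_cmult derivative_sequence_scaled_ramp_shift)
  then show ?thesis
    using derivative_sequence_shift[of "ramp_interpolant x" 2]
      derivative_sequence_diff[OF derivative_sequence_scaled_ramp_shift, of "ramp_interpolant x" \<epsilon> x]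
    by (cases u) (simp_all add: peano_kernel_def[abs_def])
qed

lemma scaled_ramp_2_eq_peano_kernel_add: "scaled_ramp \<epsilon> 2 (s - x) = peano_kernel True \<epsilon> x 2 s + peano_kernel False \<epsilon> x 0 s"
  by (simp add: peano_kernel_def numeral_2_eq_2)

lemma peano_kernel_eq_0:
  assumes "0 < \<epsilon>" "a \<le> 1/8" "a + \<epsilon> \<le> x" "x \<le> 1 - \<epsilon> - a" "s \<le> a \<or> 1 - a \<le> s"
  shows "peano_kernel u \<epsilon> x 0 s = 0"
  using assms(5)
proof
  assume "s \<le> a"
  then show ?thesis using assms(1-4)
    by (cases u) (auto simp: peano_kernel_def ramp_interpolant_def scaled_ramp_0_left scaled_ramp_2_eq_0 numeral_2_eq_2[symmetric])
next
  assume "1 - a \<le> s"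
  then show ?thesis using assms(1-4)
    by (cases u) (auto simp: peano_kernel_def ramp_interpolant_def scaled_ramp_0_right scaled_ramp_2_eq_0
        numeral_2_eq_2[symmetric] algebra_simps)
qed

lemma C1_convex_mono: "C1_convex B h \<Longrightarrow> B \<le> C \<Longrightarrow> C1_convex C h"
  unfolding C1_convex_def by (meson order_trans)

lemma C1_convex_add:
  assumes "C1_convex B f" "C1_convex C g"
  shows "C1_convex (B + C) (\<lambda>x. f x + g x)"
proof -
  obtain f' g' where "\<And>x. (f has_real_derivative f' x) (at x)" "mono f'" "\<forall>x\<in>{0..1}. \<bar>f x\<bar> \<le> B \<and> \<bar>f' x\<bar> \<le> B"
    and "\<And>x. (g has_real_derivative g' x) (at x)" "mono g'" "\<forall>x\<in>{0..1}. \<bar>g x\<bar> \<le> C \<and> \<bar>g' x\<bar> \<le> C"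
    using assms unfolding C1_convex_def by metis
  moreover from this have "mono (\<lambda>x. f' x + g' x)" by (auto simp: mono_def intro: add_mono)
  ultimately show ?thesis
    unfolding C1_convex_def
    by (intro exI[of _ "\<lambda>x. f' x + g' x"]) (auto intro!: DERIV_add order_trans[OF abs_triangle_ineq] add_mono)
qed

lemma C1_convex_affine_interpolant:
  fixes p q :: real
  assumes "\<bar>p\<bar> \<le> Q" "\<bar>q\<bar> \<le> Q"
  shows "C1_convex (4 * Q) (\<lambda>x. (3/2 - 2 * x) * p + (2 * x - 1/2) * q)"
  unfolding C1_convex_def
proof (intro exI[of _ "\<lambda>_. 2 * q - 2 * p"] conjI allI ballI)
  show "((\<lambda>x. (3/2 - 2 * x) * p + (2 * x - 1/2) * q) has_real_derivative 2 * q - 2 * p) (at x)" for x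
    by (auto intro!: derivative_eq_intros)
  show "mono (\<lambda>_::real. 2 * q - 2 * p)" by (simp add: mono_def)
  show "\<bar>2 * q - 2 * p\<bar> \<le> 4 * Q" using assms by linarith
  fix x :: real assume "x \<in> {0..1}"
  then have "\<bar>3/2 - 2 * x\<bar> \<le> 2" "\<bar>2 * x - 1/2\<bar> \<le> 2" by (auto simp: abs_le_iff)
  then have "\<bar>3/2 - 2 * x\<bar> * \<bar>p\<bar> \<le> 2 * Q" "\<bar>2 * x - 1/2\<bar> * \<bar>q\<bar> \<le> 2 * Q"
    using assms by (intro mult_mono; simp)+
  then show "\<bar>(3/2 - 2 * x) * p + (2 * x - 1/2) * q\<bar> \<le> 4 * Q"
    using abs_triangle_ineq[of "(3/2 - 2 * x) * p" "(2 * x - 1/2) * q"] by (simp add: abs_mult)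
qed

lemma C1_convex_scaled_ramp:
  assumes "0 < \<epsilon>" "\<epsilon> \<le> 1/8" "s \<in> {0..1}"
  shows "C1_convex 2 (\<lambda>x. scaled_ramp \<epsilon> 0 (s - x))"
  unfolding C1_convex_def
proof (intro exI[of _ "\<lambda>x. - scaled_ramp \<epsilon> 1 (s - x)"] conjI allI ballI)
  show "((\<lambda>x. scaled_ramp \<epsilon> 0 (s - x)) has_real_derivative - scaled_ramp \<epsilon> 1 (s - x)) (at x)" for x
    using DERIV_comp_affine[OF derivative_sequenceD[OF derivative_sequence_scaled_ramp], of \<epsilon> 0 "-1" s x]
    by (simp add: add.commute)
  show "mono (\<lambda>x. - scaled_ramp \<epsilon> 1 (s - x))"
    using scaled_ramp_1_mono[OF assms(1)] by (auto simp: mono_def)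
  fix x :: real assume "x \<in> {0..1}"
  then show "\<bar>scaled_ramp \<epsilon> 0 (s - x)\<bar> \<le> 2"
    using scaled_ramp_0_bounds[OF assms(1), of "s - x"] assms by (auto simp: abs_le_iff)
  show "\<bar>- scaled_ramp \<epsilon> 1 (s - x)\<bar> \<le> 2"
    using scaled_ramp_1_bounds[OF assms(1), of "s - x"] by linarith
qed

lemma abs_scaled_ramp_2_le_SUP:
  assumes "v \<in> {-1..1}"
  shows "\<bar>scaled_ramp (1/8) 2 v\<bar> \<le> (SUP v\<in>{-1..1}. scaled_ramp (1/8) 2 v)"
proof -
  have "compact (scaled_ramp (1/8) 2 ` {-1..1})"
    by (intro compact_continuous_image continuous_on_derivative_sequence derivative_sequence_scaled_ramp) simp
  then have "scaled_ramp (1/8) 2 v \<le> (SUP v\<in>{-1..1}. scaled_ramp (1/8) 2 v)"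
    using assms by (intro cSUP_upper bounded_imp_bdd_above compact_imp_bounded)
  then show ?thesis using scaled_ramp_2_nonneg[of "1/8" v] by simp
qed

lemma peano_kernel_bound_ge_6: "6 \<le> peano_kernel_bound"
  using abs_scaled_ramp_2_le_SUP[of 0] by (simp add: peano_kernel_bound_def)

lemma C1_convex_peano_kernel:
  assumes "0 < \<epsilon>" "\<epsilon> \<le> 1/8" "s \<in> {0..1}"
  shows "C1_convex peano_kernel_bound (\<lambda>x. peano_kernel u \<epsilon> x 0 s)"
proof (cases u)
  case True
  define p q where "p = scaled_ramp (1/8) 0 (s - 1/4)" and "q = scaled_ramp (1/8) 0 (s - 3/4)"
  have "\<bar>- p\<bar> \<le> 1" "\<bar>- q\<bar> \<le> 1"
    using scaled_ramp_0_bounds[of "1/8" "s - 1/4"] scaled_ramp_0_bounds[of "1/8" "s - 3/4"] assms(3)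
    by (auto simp: p_def q_def)
  from C1_convex_add[OF C1_convex_scaled_ramp[OF assms] C1_convex_affine_interpolant[OF this]]
  have "C1_convex 6 (\<lambda>x. peano_kernel u \<epsilon> x 0 s)"
    using True by (simp add: peano_kernel_def ramp_interpolant_def p_def q_def algebra_simps)
  then show ?thesis using peano_kernel_bound_ge_6 by (rule C1_convex_mono)
next
  case False
  have "C1_convex (4 * (SUP v\<in>{-1..1}. scaled_ramp (1/8) 2 v)) (\<lambda>x. peano_kernel u \<epsilon> x 0 s)"
    using False assms(3) C1_convex_affine_interpolant[OF abs_scaled_ramp_2_le_SUP abs_scaled_ramp_2_le_SUP, of "s - 1/4" "s - 3/4"]
    by (simp add: peano_kernel_def ramp_interpolant_def numeral_2_eq_2)
  then show ?thesis by (rule C1_convex_mono) (simp add: peano_kernel_bound_def)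
qed

lemma mollifier_eq_sum_peano_kernel:
  "mollifier \<epsilon> x s = (\<Sum>e\<in>UNIV. \<Prod>i\<in>UNIV. peano_kernel (i \<in> e) \<epsilon> (x $ i) (if i \<in> e then 2 else 0) (s $ i))"
proof -
  have "mollifier \<epsilon> x s = (\<Prod>i\<in>UNIV. peano_kernel True \<epsilon> (x $ i) 2 (s $ i) + peano_kernel False \<epsilon> (x $ i) 0 (s $ i))"
    by (simp add: mollifier_def scaled_ramp_2_eq_peano_kernel_add)
  also have "\<dots> = (\<Sum>e\<in>UNIV. (\<Prod>i\<in>e. peano_kernel True \<epsilon> (x $ i) 2 (s $ i)) * (\<Prod>i\<in>UNIV - e. peano_kernel False \<epsilon> (x $ i) 0 (s $ i)))"
    by (subst prod_add) (simp_all add: Pow_UNIV)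
  also have "\<dots> = (\<Sum>e\<in>UNIV. \<Prod>i\<in>UNIV. peano_kernel (i \<in> e) \<epsilon> (x $ i) (if i \<in> e then 2 else 0) (s $ i))"
  proof (rule sum.cong[OF refl])
    fix e
    have "(\<Prod>i\<in>UNIV. peano_kernel (i \<in> e) \<epsilon> (x $ i) (if i \<in> e then 2 else 0) (s $ i))
        = (\<Prod>i\<in>UNIV. if i \<in> e then peano_kernel True \<epsilon> (x $ i) 2 (s $ i) else peano_kernel False \<epsilon> (x $ i) 0 (s $ i))"
      by (rule prod.cong) auto
    then show "(\<Prod>i\<in>e. peano_kernel True \<epsilon> (x $ i) 2 (s $ i)) * (\<Prod>i\<in>UNIV - e. peano_kernel False \<epsilon> (x $ i) 0 (s $ i))
        = (\<Prod>i\<in>UNIV. peano_kernel (i \<in> e) \<epsilon> (x $ i) (if i \<in> e then 2 else 0) (s $ i))"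
      by (simp add: prod.If_cases Compl_eq_Diff_UNIV)
  qed
  finally show ?thesis .
qed

lemma is_weak_mixed2_peano_kernel:
  assumes weak: "is_weak_mixed2 e f g" and eps: "0 < \<epsilon>" and x: "\<And>i. \<epsilon> < x $ i \<and> x $ i < 1 - \<epsilon>"
  shows "(LINT s|lebesgue_on unit_cube. f s * (\<Prod>i\<in>UNIV. peano_kernel (i \<in> e) \<epsilon> (x $ i) (if i \<in> e then 2 else 0) (s $ i)))
       = (LINT s|lebesgue_on unit_cube. g s * (\<Prod>i\<in>UNIV. peano_kernel (i \<in> e) \<epsilon> (x $ i) 0 (s $ i)))"
proof -
  let ?\<phi> = "\<lambda>s. \<Prod>i\<in>UNIV. peano_kernel (i \<in> e) \<epsilon> (x $ i) 0 (s $ i)"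
  obtain m where m: "m > 0" "\<And>i. m \<le> min (x $ i - \<epsilon>) (1 - \<epsilon> - x $ i)"
    using finite_pos_lower_bound[of "\<lambda>i. min (x $ i - \<epsilon>) (1 - \<epsilon> - x $ i)"] x by (auto simp: algebra_simps)
  obtain xs where xs: "set xs = e" "distinct xs" using finite_distinct_list[of e] by auto
  have count: "count (mset (xs @ xs)) i = (if i \<in> e then 2 else 0)" for i
    using xs by (auto simp: distinct_count_atmost_1)
  have "test_fn ?\<phi>"
  proof (rule test_fn_prod[where a = "min m (1/8)"])
    show "peano_kernel (i \<in> e) \<epsilon> (x $ i) 0 v = 0" if "v \<le> min m (1/8) \<or> 1 - min m (1/8) \<le> v" for i v
      using m(2)[of i] that by (intro peano_kernel_eq_0[OF eps, of "min m (1/8)"]) auto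
  qed (use m(1) in \<open>auto simp: derivative_sequence_peano_kernel\<close>)
  then have "(LINT s|lebesgue_on unit_cube. f s * iter_pd (xs @ xs) ?\<phi> s) = (LINT s|lebesgue_on unit_cube. g s * ?\<phi> s)"
    using weak count unfolding is_weak_mixed2_def by blast
  then show ?thesis
    using iter_pd_prod[of "\<lambda>i. peano_kernel (i \<in> e) \<epsilon> (x $ i)" "xs @ xs", OF derivative_sequence_peano_kernel]
    by (simp only: count)
qed

lemma mollified_representation:
  fixes f :: "real^'d::finite \<Rightarrow> real" and g :: "'d set \<Rightarrow> real^'d \<Rightarrow> real"
  assumes f: "continuous_on unit_cube f" and weak: "\<And>e. is_weak_mixed2 e f (g e)"
    and eps: "0 < \<epsilon>" and x: "\<And>i. \<epsilon> < x $ i \<and> x $ i < 1 - \<epsilon>"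
  shows "(LINT s|lebesgue_on unit_cube. f s * mollifier \<epsilon> x s)
       = (\<Sum>e\<in>UNIV. LINT s|lebesgue_on unit_cube. g e s * (\<Prod>i\<in>UNIV. peano_kernel (i \<in> e) \<epsilon> (x $ i) 0 (s $ i)))"
proof -
  have "(LINT s|lebesgue_on unit_cube. f s * mollifier \<epsilon> x s)
      = (\<Sum>e\<in>UNIV. LINT s|lebesgue_on unit_cube. f s * (\<Prod>i\<in>UNIV. peano_kernel (i \<in> e) \<epsilon> (x $ i) (if i \<in> e then 2 else 0) (s $ i)))"
    unfolding mollifier_eq_sum_peano_kernel sum_distrib_left
    by (intro Bochner_Integration.integral_sum integrable_continuous_unit_cube continuous_on_mult f
        continuous_on_prod_coords continuous_on_derivative_sequence derivative_sequence_peano_kernel)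
  then show ?thesis by (simp only: is_weak_mixed2_peano_kernel[OF weak eps x])
qed

lemma measure_unit_cube: "measure (lebesgue_on unit_cube) (unit_cube :: (real^'d::finite) set) = 1"
proof -
  have "cbox 0 (1 :: real^'d) \<noteq> {}" by (simp add: interval_ne_empty_cart)
  then have "measure lebesgue (cbox 0 (1 :: real^'d)) = 1" by (simp add: content_cbox_cart)
  then show ?thesis by (simp add: measure_restrict_space unit_cube_def)
qed

lemma
  fixes g :: "real^'d::finite \<Rightarrow> real"
  assumes "in_L2 g"
  shows integrable_one_plus_square: "integrable (lebesgue_on unit_cube) (\<lambda>s. (1 + (g s)\<^sup>2) / 2)"
    and integral_one_plus_square:
      "(LINT s|lebesgue_on unit_cube. (1 + (g s)\<^sup>2) / 2) = (1 + (LINT s|lebesgue_on unit_cube. (g s)\<^sup>2)) / 2"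
proof -
  have sq: "integrable (lebesgue_on unit_cube) (\<lambda>s. (g s)\<^sup>2)" using assms by (simp add: in_L2_def)
  have const: "integrable (lebesgue_on (unit_cube :: (real^'d) set)) (\<lambda>_. 1 :: real)"
    by (intro integrable_continuous_unit_cube continuous_intros)
  show "integrable (lebesgue_on unit_cube) (\<lambda>s. (1 + (g s)\<^sup>2) / 2)" using const sq by simp
  show "(LINT s|lebesgue_on unit_cube. (1 + (g s)\<^sup>2) / 2) = (1 + (LINT s|lebesgue_on unit_cube. (g s)\<^sup>2)) / 2"
    using const sq measure_unit_cube[where 'd = 'd] by simp
qed

lemma abs_le_one_plus_square: "\<bar>x\<bar> \<le> (1 + x\<^sup>2) / 2" for x :: real
  using sum_squares_bound[of 1 "\<bar>x\<bar>"] by simp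

lemma in_L2_imp_integrable:
  assumes "in_L2 g"
  shows "integrable (lebesgue_on unit_cube) g"
  using assms abs_le_one_plus_square unfolding in_L2_def
  by (intro Bochner_Integration.integrable_bound[OF integrable_one_plus_square[OF assms]])
    (auto intro: order_trans[OF _ abs_ge_self])

lemma integral_abs_le_1:
  assumes g: "in_L2 g" "(LINT s|lebesgue_on unit_cube. (g s)\<^sup>2) \<le> 1"
  shows "(LINT s|lebesgue_on unit_cube. \<bar>g s\<bar>) \<le> 1"
proof -
  have "(LINT s|lebesgue_on unit_cube. \<bar>g s\<bar>) \<le> (LINT s|lebesgue_on unit_cube. (1 + (g s)\<^sup>2) / 2)"
    by (intro integral_mono integrable_abs in_L2_imp_integrable integrable_one_plus_square abs_le_one_plus_square g(1))
  then show ?thesis using g(2) unfolding integral_one_plus_square[OF g(1)] by simp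
qed

lemma integrable_mult_continuous:
  fixes g k :: "real^'d::finite \<Rightarrow> real"
  assumes g: "in_L2 g" and k: "continuous_on unit_cube k"
  shows "integrable (lebesgue_on unit_cube) (\<lambda>s. g s * k s)"
proof -
  obtain B where B: "\<And>s. s \<in> unit_cube \<Longrightarrow> \<bar>k s\<bar> \<le> B"
    using continuous_on_unit_cube_bounded[OF k] by blast
  show ?thesis
  proof (rule Bochner_Integration.integrable_bound)
    show "integrable (lebesgue_on unit_cube) (\<lambda>s. g s * B)" using in_L2_imp_integrable[OF g] by simp
    show "(\<lambda>s. g s * k s) \<in> borel_measurable (lebesgue_on unit_cube)"
      using g borel_measurable_integrable[OF integrable_continuous_unit_cube[OF k]]
      by (auto simp: in_L2_def)
    show "AE s in lebesgue_on unit_cube. norm (g s * k s) \<le> norm (g s * B)"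
      unfolding real_norm_def abs_mult
      using B by (intro AE_I2 mult_left_mono) (auto intro: order_trans[OF _ abs_ge_self])
  qed
qed

lemma abs_integral_mult_le:
  fixes g k :: "real^'d::finite \<Rightarrow> real"
  assumes g: "in_L2 g" "(LINT s|lebesgue_on unit_cube. (g s)\<^sup>2) \<le> 1"
    and k: "continuous_on unit_cube k" "\<And>s. s \<in> unit_cube \<Longrightarrow> \<bar>k s\<bar> \<le> B"
  shows "\<bar>LINT s|lebesgue_on unit_cube. g s * k s\<bar> \<le> B"
proof -
  have B: "0 \<le> B" using order_trans[OF abs_ge_zero k(2)[of 0]] by (simp add: mem_unit_cube)
  have "\<bar>LINT s|lebesgue_on unit_cube. g s * k s\<bar> \<le> (LINT s|lebesgue_on unit_cube. \<bar>g s * k s\<bar>)"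
    by (rule integral_abs_bound)
  also have "\<dots> \<le> (LINT s|lebesgue_on unit_cube. \<bar>g s\<bar> * B)"
    using k(2) by (intro integral_mono integrable_abs integrable_mult_continuous integrable_mult_left
        in_L2_imp_integrable g(1) k(1)) (auto simp: abs_mult intro!: mult_left_mono)
  also have "\<dots> \<le> B"
    using integral_abs_le_1[OF g] B by (simp add: mult_left_le_one_le)
  finally show ?thesis .
qed

lemma abs_mollified_functional_le:
  fixes f :: "real^'d::finite \<Rightarrow> real" and g :: "'d set \<Rightarrow> real^'d \<Rightarrow> real"
  assumes f: "continuous_on unit_cube f" and weak: "\<And>e. is_weak_mixed2 e f (g e)"
    and g: "\<And>e. in_L2 (g e)" "\<And>e. (LINT s|lebesgue_on unit_cube. (g e s)\<^sup>2) \<le> 1"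
    and eps: "0 < \<epsilon>" and S: "\<And>a i. a \<in> S \<Longrightarrow> \<epsilon> < p a $ i \<and> p a $ i < 1 - \<epsilon>"
    and B: "\<And>e s. s \<in> unit_cube \<Longrightarrow> \<bar>\<Sum>a\<in>S. w a * (\<Prod>i\<in>UNIV. peano_kernel (i \<in> e) \<epsilon> (p a $ i) 0 (s $ i))\<bar> \<le> B"
  shows "\<bar>\<Sum>a\<in>S. w a * (LINT s|lebesgue_on unit_cube. f s * mollifier \<epsilon> (p a) s)\<bar> \<le> 2 ^ CARD('d) * B"
proof -
  define k where "k e a s = (\<Prod>i\<in>UNIV. peano_kernel (i \<in> e) \<epsilon> (p a $ i) 0 (s $ i))" for e a and s :: "real^'d"
  have cont: "continuous_on unit_cube (k e a)" for e a
    unfolding k_def by (intro continuous_on_prod_coords continuous_on_derivative_sequence derivative_sequence_peano_kernel)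
  have int: "integrable (lebesgue_on unit_cube) (\<lambda>s. g e s * k e a s)" for e a
    by (rule integrable_mult_continuous[OF g(1) cont])
  have "(\<Sum>a\<in>S. w a * (LINT s|lebesgue_on unit_cube. f s * mollifier \<epsilon> (p a) s))
      = (\<Sum>a\<in>S. \<Sum>e\<in>UNIV. LINT s|lebesgue_on unit_cube. w a * (g e s * k e a s))"
    using mollified_representation[OF f weak eps S] by (simp add: k_def sum_distrib_left)
  also have "\<dots> = (\<Sum>e\<in>UNIV. LINT s|lebesgue_on unit_cube. g e s * (\<Sum>a\<in>S. w a * k e a s))"
    using int by (subst sum.swap) (simp add: sum_distrib_left mult.left_commute)
  also have "\<bar>\<dots>\<bar> \<le> (\<Sum>e\<in>UNIV. \<bar>LINT s|lebesgue_on unit_cube. g e s * (\<Sum>a\<in>S. w a * k e a s)\<bar>)"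
    by (rule sum_abs)
  also have "\<dots> \<le> (\<Sum>e\<in>(UNIV :: 'd set set). B)"
    using B by (intro sum_mono abs_integral_mult_le g continuous_intros cont) (simp add: k_def)
  also have "\<dots> = 2 ^ CARD('d) * B" by (simp add: card_Pow flip: Pow_UNIV)
  finally show ?thesis .
qed

definition H2mix_ball :: "(real^'d::finite \<Rightarrow> real) set" where
  "H2mix_ball = {f. f \<in> H2mix \<and> continuous_on unit_cube f \<and> H2mix_norm f \<le> 1}"

lemma
  assumes "f \<in> H2mix"
  shows in_L2_weak_D: "in_L2 (weak_D e f)" and is_weak_mixed2_weak_D: "is_weak_mixed2 e f (weak_D e f)"
proof -
  have "\<exists>g. in_L2 g \<and> is_weak_mixed2 e f g" using assms by (simp add: H2mix_def)
  from someI_ex[OF this] show "in_L2 (weak_D e f)" "is_weak_mixed2 e f (weak_D e f)"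
    unfolding weak_D_def by auto
qed

lemma integral_weak_D_square_le:
  assumes "H2mix_norm f \<le> 1"
  shows "(LINT s|lebesgue_on unit_cube. (weak_D e f s)\<^sup>2) \<le> 1"
proof -
  have "(LINT s|lebesgue_on unit_cube. (weak_D e f s)\<^sup>2) \<le> (\<Sum>e\<in>UNIV. LINT s|lebesgue_on unit_cube. (weak_D e f s)\<^sup>2)"
    by (rule member_le_sum) auto
  also have "\<dots> \<le> 1" using assms unfolding H2mix_norm_def by (simp add: real_sqrt_le_1_iff)
  finally show ?thesis .
qed

proposition abs_H2mix_ball_functional_le:
  fixes f :: "real^'d::finite \<Rightarrow> real"
  assumes f: "f \<in> H2mix_ball" and S: "finite S" "\<And>a. a \<in> S \<Longrightarrow> p a \<in> box 0 1"
    and B: "\<And>h. (\<And>i. C1_convex peano_kernel_bound (h i)) \<Longrightarrow> \<bar>\<Sum>a\<in>S. w a * (\<Prod>i\<in>UNIV. h i (p a $ i))\<bar> \<le> B"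
  shows "\<bar>\<Sum>a\<in>S. w a * f (p a)\<bar> \<le> 2 ^ CARD('d) * B"
proof (rule tendsto_upperbound)
  let ?M = "\<lambda>\<epsilon> a. LINT s|lebesgue_on unit_cube. f s * mollifier \<epsilon> (p a) s"
  have f_props: "f \<in> H2mix" "continuous_on unit_cube f" "H2mix_norm f \<le> 1"
    using f by (auto simp: H2mix_ball_def)
  show "((\<lambda>\<epsilon>. \<bar>\<Sum>a\<in>S. w a * ?M \<epsilon> a\<bar>) \<longlongrightarrow> \<bar>\<Sum>a\<in>S. w a * f (p a)\<bar>) (at_right 0)"
    using S by (intro tendsto_rabs tendsto_sum tendsto_mult tendsto_const mollifier_tendsto f_props)
  have "\<forall>\<^sub>F \<epsilon> in at_right 0. \<forall>a\<in>S. \<forall>i. \<epsilon> < p a $ i \<and> p a $ i < 1 - \<epsilon>"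
  proof (intro eventually_ball_finite ballI eventually_all_finite eventually_conj S(1))
    fix a i assume "a \<in> S"
    then have "0 < p a $ i" "0 < 1 - p a $ i" using S(2) by (auto simp: mem_box_cart)
    then show "\<forall>\<^sub>F \<epsilon> in at_right 0. \<epsilon> < p a $ i" "\<forall>\<^sub>F \<epsilon> in at_right 0. p a $ i < 1 - \<epsilon>"
      by (auto intro: eventually_at_rightI[of 0 "p a $ i"] eventually_at_rightI[of 0 "1 - p a $ i"])
  qed
  moreover have "\<forall>\<^sub>F \<epsilon> in at_right (0::real). 0 < \<epsilon> \<and> \<epsilon> < 1/8"
    by (intro eventually_at_rightI[of _ "1/8"]) auto
  ultimately show "\<forall>\<^sub>F \<epsilon> in at_right 0. \<bar>\<Sum>a\<in>S. w a * ?M \<epsilon> a\<bar> \<le> 2 ^ CARD('d) * B"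
  proof eventually_elim
    case (elim \<epsilon>)
    show ?case
    proof (rule abs_mollified_functional_le[OF f_props(2) is_weak_mixed2_weak_D in_L2_weak_D integral_weak_D_square_le])
      fix e and s :: "real^'d" assume "s \<in> unit_cube"
      then show "\<bar>\<Sum>a\<in>S. w a * (\<Prod>i\<in>UNIV. peano_kernel (i \<in> e) \<epsilon> (p a $ i) 0 (s $ i))\<bar> \<le> B"
        using elim by (intro B C1_convex_peano_kernel) (auto simp: mem_unit_cube)
    qed (use elim f_props in auto)
  qed
qed simp

section \<open>Midpoint sums\<close>

definition cell_mid :: "nat \<Rightarrow> nat \<Rightarrow> real" where
  "cell_mid m j = (real j + 1/2) / real m"

text \<open>The minimum puts the face \<open>x = 1\<close> into the last cell, so that the cells partition the closed cube.\<close>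

definition cell_index :: "nat \<Rightarrow> real \<Rightarrow> nat" where
  "cell_index m x = min (m - 1) (nat \<lfloor>real m * x\<rfloor>)"

definition cell :: "nat \<Rightarrow> ('d::finite \<Rightarrow> nat) \<Rightarrow> (real^'d) set" where
  "cell m j = {s \<in> unit_cube. \<forall>i. cell_index m (s $ i) = j i}"

lemma cell_index_less: "m > 0 \<Longrightarrow> cell_index m x < m"
  by (auto simp: cell_index_def min_less_iff_disj)

lemma cell_index_bounds:
  assumes "m > 0" "x \<in> {0..1}"
  shows "real (cell_index m x) / real m \<le> x" "x \<le> (real (cell_index m x) + 1) / real m"
proof -
  define k where "k = nat \<lfloor>real m * x\<rfloor>"
  have k: "real k \<le> real m * x" "real m * x < real k + 1"
    using assms unfolding k_def by (auto simp: of_nat_nat)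
  have "real (cell_index m x) \<le> real k" by (simp add: cell_index_def k_def)
  then show "real (cell_index m x) / real m \<le> x" using k assms(1) by (simp add: field_simps)
  have "real m * x \<le> real (cell_index m x) + 1"
  proof (cases "k \<le> m - 1")
    case True
    then show ?thesis using k by (simp add: cell_index_def k_def[symmetric])
  next
    case False
    then have "real (cell_index m x) + 1 = real m"
      using assms(1) by (simp add: cell_index_def k_def[symmetric] of_nat_diff)
    then show ?thesis using assms by (simp add: mult_left_le)
  qed
  then show "x \<le> (real (cell_index m x) + 1) / real m" using assms(1) by (simp add: field_simps)
qed

lemma cell_index_eqI:
  assumes "j < m" "real j / real m < x" "x < (real j + 1) / real m"
  shows "cell_index m x = j"
proof -
  have "\<lfloor>real m * x\<rfloor> = int j" using assms by (intro floor_unique) (auto simp: field_simps)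
  then show ?thesis using assms(1) by (simp add: cell_index_def)
qed

lemma cell_mid_cell_index_tendsto:
  assumes "x \<in> {0..1}"
  shows "(\<lambda>m. cell_mid m (cell_index m x)) \<longlonglongrightarrow> x"
proof (rule LIM_zero_cancel, rule Lim_null_comparison)
  show "\<forall>\<^sub>F m in sequentially. norm (cell_mid m (cell_index m x) - x) \<le> 1 / real m"
    using eventually_gt_at_top[of 0]
  proof eventually_elim
    case (elim m)
    then show ?case using cell_index_bounds[OF elim assms] by (simp add: cell_mid_def abs_le_iff add_divide_distrib)
  qed
  show "(\<lambda>m. 1 / real m) \<longlonglongrightarrow> 0" by (rule lim_const_over_n)
qed

lemma cell_mid_in_unit_interval: "j < m \<Longrightarrow> cell_mid m j \<in> {0..1}"
  by (simp add: cell_mid_def field_simps)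

lemma cell_mid_reflect: "j < m \<Longrightarrow> cell_mid m (m - Suc j) = 1 - cell_mid m j"
  by (simp add: cell_mid_def of_nat_diff field_simps)

lemma cell_between_boxes:
  fixes j :: "'d::finite \<Rightarrow> nat"
  assumes "\<And>i. j i < m"
  defines "a \<equiv> \<chi> i. real (j i) / real m" and "b \<equiv> \<chi> i. (real (j i) + 1) / real m"
  shows "box a b \<subseteq> cell m j" "cell m j \<subseteq> cbox a b"
proof -
  show "box a b \<subseteq> cell m j"
  proof
    fix s assume "s \<in> box a b"
    then have s: "real (j i) / real m < s $ i" "s $ i < (real (j i) + 1) / real m" for i
      by (auto simp: mem_box_cart a_def b_def)
    have "0 \<le> real (j i) / real m" "(real (j i) + 1) / real m \<le> 1" for i
      using assms(1)[of i] by auto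
    then have "0 \<le> s $ i \<and> s $ i \<le> 1" for i using s[of i] by (meson less_imp_le order_trans)
    then show "s \<in> cell m j" using s assms(1) by (simp add: cell_def mem_unit_cube cell_index_eqI)
  qed
  show "cell m j \<subseteq> cbox a b"
  proof
    fix s assume s: "s \<in> cell m j"
    have "m > 0" using assms(1)[of undefined] by simp
    from s cell_index_bounds[OF this, of "s $ _"] show "s \<in> cbox a b"
      by (force simp: mem_box_cart a_def b_def cell_def mem_unit_cube)
  qed
qed

lemma
  fixes j :: "'d::finite \<Rightarrow> nat"
  assumes j: "\<And>i. j i < m"
  shows sets_cell: "cell m j \<in> sets lebesgue" and measure_cell: "measure lebesgue (cell m j) = 1 / real m ^ CARD('d)"
proof -
  define a b where "a = (\<chi> i. real (j i) / real m :: real^'d)" and "b = (\<chi> i. (real (j i) + 1) / real m :: real^'d)"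
  note between = cell_between_boxes[of j m, OF j, folded a_def b_def]
  have "negligible (cell m j - box a b)"
    by (rule negligible_subset[OF negligible_frontier_interval[of a b]]) (use between(2) in auto)
  then have "box a b \<union> (cell m j - box a b) \<in> sets lebesgue"
    by (intro sets.Un) (auto intro: negligible_imp_sets)
  then show sets: "cell m j \<in> sets lebesgue" using between(1) by (simp add: Un_absorb1)
  have vol: "(\<Prod>v\<in>Basis. (b - a) \<bullet> v) = 1 / real m ^ CARD('d)"
    by (simp add: prod_Basis_vec inner_axis a_def b_def add_divide_distrib power_one_over)
  have le: "\<forall>v\<in>Basis. a \<bullet> v \<le> b \<bullet> v"
    by (auto simp: Basis_vec_def inner_axis a_def b_def divide_right_mono)
  have "emeasure lebesgue (cell m j) \<le> emeasure lebesgue (cbox a b)"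
    "emeasure lebesgue (box a b) \<le> emeasure lebesgue (cell m j)"
    using between sets by (intro emeasure_mono; simp)+
  then have "emeasure lebesgue (cell m j) = ennreal (1 / real m ^ CARD('d))"
    using le vol by (simp add: emeasure_lborel_cbox_eq emeasure_lborel_box_eq)
  then show "measure lebesgue (cell m j) = 1 / real m ^ CARD('d)"
    by (simp add: measure_def)
qed

lemma has_bochner_integral_indicator_cell:
  fixes j :: "'d::finite \<Rightarrow> nat"
  assumes j: "\<And>i. j i < m"
  shows "has_bochner_integral (lebesgue_on unit_cube) (indicat_real (cell m j)) (1 / real m ^ CARD('d))"
proof -
  have cube: "(unit_cube :: (real^'d) set) \<in> lmeasurable" by (simp add: unit_cube_def)
  then have sets: "cell m j \<in> sets (lebesgue_on unit_cube)"
    using sets_cell[OF j] by (auto simp: sets_restrict_space_iff fmeasurableD cell_def)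
  have "emeasure (lebesgue_on unit_cube) (cell m j) < \<infinity>"
    using finite_measure.emeasure_finite[OF finite_measure_lebesgue_on[OF cube]] by (simp add: less_top)
  moreover have "measure (lebesgue_on unit_cube) (cell m j) = 1 / real m ^ CARD('d)"
    using measure_cell[OF j] cube by (subst measure_restrict_space) (auto simp: cell_def fmeasurableD)
  ultimately show ?thesis using has_bochner_integral_real_indicator[OF sets] by simp
qed

lemma has_bochner_integral_midpoint_step:
  fixes f :: "real^'d::finite \<Rightarrow> real"
  assumes m: "m > 0"
  shows "has_bochner_integral (lebesgue_on unit_cube) (\<lambda>s. f (\<chi> i. cell_mid m (cell_index m (s $ i))))
      ((\<Sum>j\<in>PiE UNIV (\<lambda>_. {..<m}). f (\<chi> i. cell_mid m (j i))) / real m ^ CARD('d))"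
proof -
  define J where "J = PiE (UNIV :: 'd set) (\<lambda>_. {..<m})"
  have "finite J" by (simp add: J_def finite_PiE)
  have step: "(\<Sum>j\<in>J. f (\<chi> i. cell_mid m (j i)) * indicator (cell m j) s) = f (\<chi> i. cell_mid m (cell_index m (s $ i)))"
    if s: "s \<in> space (lebesgue_on unit_cube)" for s
  proof -
    let ?j = "\<lambda>i. cell_index m (s $ i)"
    have "(\<Sum>j\<in>J. f (\<chi> i. cell_mid m (j i)) * indicator (cell m j) s)
        = (\<Sum>j\<in>J. if j = ?j then f (\<chi> i. cell_mid m (j i)) else 0)"
      using s by (intro sum.cong) (auto simp: cell_def indicator_def fun_eq_iff)
    also have "\<dots> = f (\<chi> i. cell_mid m (?j i))"
      using \<open>finite J\<close> m by (subst sum.delta) (auto simp: J_def cell_index_less)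
    finally show ?thesis .
  qed
  have "has_bochner_integral (lebesgue_on unit_cube) (\<lambda>s. \<Sum>j\<in>J. f (\<chi> i. cell_mid m (j i)) * indicator (cell m j) s)
      (\<Sum>j\<in>J. f (\<chi> i. cell_mid m (j i)) * (1 / real m ^ CARD('d)))"
    by (intro has_bochner_integral_sum has_bochner_integral_mult_right has_bochner_integral_indicator_cell)
      (auto simp: J_def)
  then show ?thesis
    by (subst (asm) has_bochner_integral_cong[OF refl step refl]) (simp_all add: J_def sum_divide_distrib)
qed

proposition midpoint_sum_tendsto:
  fixes f :: "real^'d::finite \<Rightarrow> real"
  assumes f: "continuous_on unit_cube f"
  shows "(\<lambda>m. (\<Sum>j\<in>PiE UNIV (\<lambda>_. {..<m}). f (\<chi> i. cell_mid m (j i))) / real m ^ CARD('d))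
     \<longlonglongrightarrow> (LINT s|lebesgue_on unit_cube. f s)"
proof (rule LIMSEQ_imp_Suc)
  define P where "P m s = (\<chi> i. cell_mid (Suc m) (cell_index (Suc m) (s $ i)))" for m and s :: "real^'d"
  have P_in: "P m s \<in> unit_cube" for m s
    using cell_mid_in_unit_interval[OF cell_index_less] by (simp add: P_def mem_unit_cube)
  have P_tendsto: "(\<lambda>m. P m s) \<longlonglongrightarrow> s" if "s \<in> unit_cube" for s
  proof (rule vec_tendstoI)
    fix i
    show "(\<lambda>m. P m s $ i) \<longlonglongrightarrow> s $ i"
      using that LIMSEQ_Suc[OF cell_mid_cell_index_tendsto[of "s $ i"]] by (simp add: P_def mem_unit_cube)
  qed
  obtain B where B: "\<And>s. s \<in> unit_cube \<Longrightarrow> \<bar>f s\<bar> \<le> B"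
    using continuous_on_unit_cube_bounded[OF f] by blast
  have "(\<lambda>m. LINT s|lebesgue_on unit_cube. f (P m s)) \<longlonglongrightarrow> (LINT s|lebesgue_on unit_cube. f s)"
  proof (rule integral_dominated_convergence[where w = "\<lambda>_. B"])
    show "f \<in> borel_measurable (lebesgue_on unit_cube)"
      using integrable_continuous_unit_cube[OF f] by simp
    show "integrable (lebesgue_on (unit_cube :: (real^'d) set)) (\<lambda>_. B)"
      by (intro integrable_continuous_unit_cube continuous_intros)
    show "(\<lambda>s. f (P m s)) \<in> borel_measurable (lebesgue_on unit_cube)" for m
      using has_bochner_integral_midpoint_step[of "Suc m" f]
      by (simp add: P_def has_bochner_integral_iff borel_measurable_integrable)
    show "AE s in lebesgue_on unit_cube. norm (f (P m s)) \<le> B" for m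
      using B[OF P_in] by simp
    show "AE s in lebesgue_on unit_cube. (\<lambda>m. f (P m s)) \<longlonglongrightarrow> f s"
      using P_in P_tendsto by (intro AE_I2 continuous_on_tendsto_compose[OF f]) auto
  qed
  then show "(\<lambda>m. (\<Sum>j\<in>PiE UNIV (\<lambda>_. {..<Suc m}). f (\<chi> i. cell_mid (Suc m) (j i))) / real (Suc m) ^ CARD('d))
     \<longlonglongrightarrow> (LINT s|lebesgue_on unit_cube. f s)"
    by (simp only: P_def has_bochner_integral_integral_eq[OF has_bochner_integral_midpoint_step[OF zero_less_Suc, of f]])
qed

lemma sum_Pow_dyadic_mid:
  fixes F :: "real \<Rightarrow> 'a::comm_monoid_add"
  shows "(\<Sum>A\<in>Pow {..<L}. F (dyadic_mid L A)) = (\<Sum>j<2 ^ L. F (cell_mid (2 ^ L) j))"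
proof (induction L arbitrary: F)
  case 0
  then show ?case by (simp add: dyadic_mid_def cell_mid_def)
next
  case (Suc L)
  define G where "G j = F (cell_mid (2 ^ Suc L) j)" for j
  have halves: "F (cell_mid (2 ^ L) j / 2) = G j" "F ((cell_mid (2 ^ L) j + 1) / 2) = G (j + 2 ^ L)" for j
    by (auto simp: G_def cell_mid_def field_simps intro!: arg_cong[of _ _ F])
  have "(\<Sum>A\<in>Pow {..<Suc L}. F (dyadic_mid (Suc L) A))
      = (\<Sum>B\<in>Pow {..<L}. F (dyadic_mid L B / 2)) + (\<Sum>B\<in>Pow {..<L}. F ((dyadic_mid L B + 1) / 2))"
    unfolding sum_Pow_lessThan_Suc sum.distrib[symmetric]
    by (intro sum.cong refl) (simp only: finite_of_Pow_lessThan dyadic_mid_image_Suc dyadic_mid_insert_0)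
  also have "\<dots> = (\<Sum>j<2 ^ L. G j) + (\<Sum>j<2 ^ L. G (j + 2 ^ L))"
    using Suc.IH[of "\<lambda>x. F (x / 2)"] Suc.IH[of "\<lambda>x. F ((x + 1) / 2)"] by (simp only: halves)
  also have "\<dots> = (\<Sum>j<2 ^ Suc L. G j)"
    using sum.atLeastLessThan_concat[of 0 "2 ^ L" "2 ^ Suc L" G] sum.shift_bounds_nat_ivl[of G 0 "2 ^ L" "2 ^ L"]
    by (simp add: atLeast0LessThan mult_2)
  finally show ?case by (simp only: G_def)
qed

lemma tent_dyadic_mid:
  assumes "B \<subseteq> {..<K}"
  shows "\<bar>2 * dyadic_mid (Suc K) (Suc ` B) - 1\<bar> = 1 - dyadic_mid K B"
    "\<bar>2 * dyadic_mid (Suc K) (insert 0 (Suc ` B)) - 1\<bar> = dyadic_mid K B"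
  using assms dyadic_mid_in_unit_interval[OF assms] finite_of_Pow_lessThan[of B K]
  by (simp_all add: dyadic_mid_image_Suc dyadic_mid_insert_0 add_divide_distrib distrib_left)

lemma sum_Pow_tent_dyadic_mid:
  fixes F :: "real \<Rightarrow> real"
  shows "(\<Sum>A\<in>Pow {..<Suc K}. F \<bar>2 * dyadic_mid (Suc K) A - 1\<bar>) = 2 * (\<Sum>j<2 ^ K. F (cell_mid (2 ^ K) j))"
proof -
  have "(\<Sum>A\<in>Pow {..<Suc K}. F \<bar>2 * dyadic_mid (Suc K) A - 1\<bar>)
      = (\<Sum>B\<in>Pow {..<K}. F (1 - dyadic_mid K B)) + (\<Sum>B\<in>Pow {..<K}. F (dyadic_mid K B))"
    unfolding sum_Pow_lessThan_Suc sum.distrib[symmetric] by (intro sum.cong) (simp_all add: tent_dyadic_mid)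
  also have "(\<Sum>B\<in>Pow {..<K}. F (1 - dyadic_mid K B)) = (\<Sum>j<2 ^ K. F (1 - cell_mid (2 ^ K) j))"
    by (rule sum_Pow_dyadic_mid)
  also have "\<dots> = (\<Sum>j<2 ^ K. F (cell_mid (2 ^ K) (2 ^ K - Suc j)))"
    by (intro sum.cong refl) (simp add: cell_mid_reflect)
  also have "\<dots> = (\<Sum>j<2 ^ K. F (cell_mid (2 ^ K) j))"
    by (rule sum.nat_diff_reindex)
  finally show ?thesis by (simp add: sum_Pow_dyadic_mid)
qed

lemma sum_PiE_by_values:
  fixes f :: "real^'d::finite \<Rightarrow> real"
  assumes "finite S" "finite V" "\<phi> ` S \<subseteq> V"
  shows "(\<Sum>A\<in>PiE UNIV (\<lambda>_. S). f (\<chi> i. \<phi> (A i)))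
       = (\<Sum>y\<in>PiE UNIV (\<lambda>_. V). f (\<chi> i. y i) * (\<Prod>i\<in>UNIV. \<Sum>a\<in>S. of_bool (\<phi> a = y i)))"
proof -
  have "f (\<chi> i. \<phi> (A i)) = (\<Sum>y\<in>PiE UNIV (\<lambda>_. V). f (\<chi> i. y i) * (\<Prod>i\<in>UNIV. of_bool (\<phi> (A i) = y i)))"
    if "A \<in> PiE UNIV (\<lambda>_. S)" for A
  proof -
    have "(\<Prod>i\<in>UNIV. of_bool (\<phi> (A i) = y i)) = (if y = (\<lambda>i. \<phi> (A i)) then 1 else 0 :: real)" for y
      by (auto intro: prod_zero)
    moreover have "(\<lambda>i. \<phi> (A i)) \<in> PiE UNIV (\<lambda>_. V)" using that assms(3) by auto
    ultimately show ?thesis using assms(2) by (simp add: finite_PiE if_distrib[of "(*) _"] cong: if_cong)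
  qed
  then have "(\<Sum>A\<in>PiE UNIV (\<lambda>_. S). f (\<chi> i. \<phi> (A i)))
      = (\<Sum>y\<in>PiE UNIV (\<lambda>_. V). \<Sum>A\<in>PiE UNIV (\<lambda>_. S). f (\<chi> i. y i) * (\<Prod>i\<in>UNIV. of_bool (\<phi> (A i) = y i)))"
    by (subst sum.swap) simp
  then show ?thesis using assms(1) by (simp add: prod_sum_PiE sum_distrib_left del: sum_of_bool_eq)
qed

lemma sum_PiE_transfer:
  fixes f :: "real^'d::finite \<Rightarrow> real"
  assumes fin: "finite S" "finite T"
    and transfer: "\<And>F :: real \<Rightarrow> real. (\<Sum>a\<in>S. F (\<phi> a)) = c * (\<Sum>b\<in>T. F (\<psi> b))"
  shows "(\<Sum>A\<in>PiE UNIV (\<lambda>_. S). f (\<chi> i. \<phi> (A i))) = c ^ CARD('d) * (\<Sum>B\<in>PiE UNIV (\<lambda>_. T). f (\<chi> i. \<psi> (B i)))"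
proof -
  let ?V = "\<phi> ` S \<union> \<psi> ` T"
  have "(\<Sum>A\<in>PiE UNIV (\<lambda>_. S). f (\<chi> i. \<phi> (A i)))
      = (\<Sum>y\<in>PiE UNIV (\<lambda>_. ?V). f (\<chi> i. y i) * (\<Prod>i\<in>UNIV. c * (\<Sum>b\<in>T. of_bool (\<psi> b = y i))))"
    using fin by (subst sum_PiE_by_values[of _ ?V]) (simp_all add: transfer[of "\<lambda>v. of_bool (v = _)"])
  also have "\<dots> = c ^ CARD('d) * (\<Sum>B\<in>PiE UNIV (\<lambda>_. T). f (\<chi> i. \<psi> (B i)))"
    using fin by (subst sum_PiE_by_values[of T ?V \<psi>]) (simp_all add: prod.distrib sum_distrib_left mult_ac)
  finally show ?thesis .
qed

definition tent_mid :: "nat \<Rightarrow> ('d::finite \<Rightarrow> nat set) \<Rightarrow> real^'d" where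
  "tent_mid L A = tent (\<chi> i. dyadic_mid L (A i))"

lemma tent_mid_nth: "tent_mid L A $ i = \<bar>2 * dyadic_mid L (A i) - 1\<bar>"
  by (simp add: tent_mid_def tent_def)

lemma tent_mid_in_box:
  assumes "A \<in> digit_sets (Suc K)"
  shows "tent_mid (Suc K) A \<in> box 0 1"
proof -
  have "0 < tent_mid (Suc K) A $ i \<and> tent_mid (Suc K) A $ i < 1" for i
  proof -
    define B where "B = Suc -` A i"
    have B: "B \<subseteq> {..<K}" using assms by (auto simp: B_def digit_sets_iff)
    have "A i = (if 0 \<in> A i then insert 0 (Suc ` B) else Suc ` B)"
      using Suc_image_vimage_Suc[of "A i"] by (auto simp: B_def)
    then have "tent_mid (Suc K) A $ i = (if 0 \<in> A i then dyadic_mid K B else 1 - dyadic_mid K B)"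
      using tent_dyadic_mid[OF B] by (metis tent_mid_nth)
    then show ?thesis using dyadic_mid_in_unit_interval[OF B] by auto
  qed
  then show ?thesis by (simp add: mem_box_cart)
qed

lemma tent_mid_sum:
  fixes f :: "real^'d::finite \<Rightarrow> real"
  shows "(\<Sum>A\<in>digit_sets (Suc K). f (tent_mid (Suc K) A)) / 2 ^ (Suc K * CARD('d))
       = (\<Sum>j\<in>PiE UNIV (\<lambda>_. {..<2 ^ K}). f (\<chi> i. cell_mid (2 ^ K) (j i))) / real (2 ^ K) ^ CARD('d)"
proof -
  have "(\<Sum>A\<in>digit_sets (Suc K). f (tent_mid (Suc K) A))
      = 2 ^ CARD('d) * (\<Sum>j\<in>PiE UNIV (\<lambda>_. {..<2 ^ K}). f (\<chi> i. cell_mid (2 ^ K) (j i)))"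
    unfolding digit_sets_def tent_mid_def tent_def
    using sum_PiE_transfer[of "Pow {..<Suc K}" "{..<2 ^ K}", OF _ _ sum_Pow_tent_dyadic_mid] by simp
  then show ?thesis by (simp add: power_add power_mult)
qed

lemma tent_mid_sum_tendsto:
  fixes f :: "real^'d::finite \<Rightarrow> real"
  assumes f: "continuous_on unit_cube f"
  shows "(\<lambda>L. (\<Sum>A\<in>digit_sets L. f (tent_mid L A)) / 2 ^ (L * CARD('d))) \<longlonglongrightarrow> (LINT s|lebesgue_on unit_cube. f s)"
proof (rule LIMSEQ_imp_Suc)
  have "filterlim (\<lambda>K. 2 ^ K :: nat) at_top sequentially"
    by (intro filterlim_subseq strict_monoI) simp
  from filterlim_compose[OF midpoint_sum_tendsto[OF f] this]
  show "(\<lambda>K. (\<Sum>A\<in>digit_sets (Suc K). f (tent_mid (Suc K) A)) / 2 ^ (Suc K * CARD('d)))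
      \<longlonglongrightarrow> (LINT s|lebesgue_on unit_cube. f s)"
    by (simp only: tent_mid_sum)
qed

section \<open>The error bound\<close>

lemma separated_dual_net:
  assumes net: "is_order_digital_net 2 t n Cm"
  shows "separated (2 * n - t) (dual_net n Cm L)"
  unfolding separated_def
proof (intro ballI impI)
  fix S T assume ST: "S \<in> dual_net n Cm L" "T \<in> dual_net n Cm L" "S \<noteq> T"
  then have "\<exists>i. sym_diff (S i) (T i) \<noteq> {}" by (auto simp: fun_eq_iff)
  then have "(\<lambda>i. sym_diff (S i) (T i)) \<noteq> (\<lambda>_. {})" by (metis (no_types))
  then show "2 * n - t < weight2 (\<lambda>i. sym_diff (S i) (T i))"
    by (rule weight2_dual_net_gt[OF net dual_net_sym_diff[OF ST(1,2)]])
qed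

definition grid_functional ::
    "nat \<Rightarrow> ('d::finite \<Rightarrow> nat \<Rightarrow> nat \<Rightarrow> bool) \<Rightarrow> nat \<Rightarrow> (real^'d \<Rightarrow> real) \<Rightarrow> real" where
  "grid_functional n Cm L F = (\<Sum>A\<in>digit_sets L. grid_weight n Cm L A * F (tent_mid L A))"

lemma abs_grid_functional_prod_le:
  fixes Cm :: "'d::finite \<Rightarrow> nat \<Rightarrow> nat \<Rightarrow> bool" and h :: "'d \<Rightarrow> real \<Rightarrow> real"
  assumes net: "is_order_digital_net 2 t n Cm" and L: "2 * n \<le> L" and h: "\<And>i. C1_convex C (h i)"
  defines "M \<equiv> 2 * n - t" and "q \<equiv> 2 * CARD('d) - 1"
  shows "\<bar>grid_functional n Cm L (\<lambda>x. \<Prod>i\<in>UNIV. h i (x $ i))\<bar>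
     \<le> (8 * C) ^ CARD('d) * (separated_const q * ((1/2) ^ M * (real M + 1) ^ q))"
proof -
  define E where "E = dual_net n Cm L - {\<lambda>_. {}}"
  define c where "c T i = walsh_coeff L (T i) (\<lambda>y. h i \<bar>2 * y - 1\<bar>)" for T i
  have E: "E \<subseteq> digit_sets L" by (auto simp: E_def dual_net_def)
  then have T_sub: "T i \<subseteq> {..<L}" if "T \<in> E" for T i using that digit_sets_iff by blast
  have C: "C \<ge> 0" using C1_convex_nonneg[OF h] .
  have "grid_functional n Cm L (\<lambda>x. \<Prod>i\<in>UNIV. h i (x $ i)) = (\<Sum>T\<in>E. \<Prod>i\<in>UNIV. c T i)"
    using sum_grid_weight_prod[OF L, of Cm "\<lambda>i y. h i \<bar>2 * y - 1\<bar>"]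
    by (simp add: grid_functional_def tent_mid_nth E_def c_def)
  also have "\<bar>\<dots>\<bar> \<le> (\<Sum>T\<in>E. \<Prod>i\<in>UNIV. \<bar>c T i\<bar>)"
    unfolding abs_prod[symmetric] by (rule sum_abs)
  also have "\<dots> \<le> (\<Sum>T\<in>E. \<Prod>i\<in>UNIV. 8 * C * (1/2) ^ top_sum 2 (Suc ` T i))"
    unfolding c_def using T_sub by (intro sum_mono prod_mono conjI abs_walsh_coeff_tent_le h) auto
  also have "\<dots> = (8 * C) ^ CARD('d) * (\<Sum>T\<in>E. (1/2) ^ weight2 T)"
    by (simp add: prod.distrib weight2_def power_sum sum_distrib_left)
  also have "\<dots> \<le> (8 * C) ^ CARD('d) * (separated_const q * ((1/2) ^ M * (real M + 1) ^ q))"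
  proof (intro mult_left_mono)
    have "separated M E"
      using separated_dual_net[OF net] unfolding M_def by (rule separated_subset) (auto simp: E_def)
    moreover have "M \<le> weight2 T" if "T \<in> E" for T
      using weight2_dual_net_gt[OF net] that by (auto simp: E_def M_def intro: less_imp_le)
    ultimately show "(\<Sum>T\<in>E. (1/2) ^ weight2 T) \<le> separated_const q * ((1/2) ^ M * (real M + 1) ^ q)"
      unfolding q_def by (intro sum_half_power_weight2_le[OF E])
  qed (use C in simp)
  finally show ?thesis .
qed

lemma dyadic_mid_net_digits:
  assumes "2 * n \<le> L"
  shows "dyadic_mid L (net_digits n Cm k i) = net_point 2 n Cm k $ i + (1/2) ^ Suc L"
proof -
  have "net_point 2 n Cm k $ i = (\<Sum>l=Suc 0..<Suc (2 * n). if digit n Cm i l k then (1/2) ^ l else 0)"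
    unfolding net_point_def vec_lambda_beta by (rule sum.cong) auto
  also have "\<dots> = (\<Sum>l<2 * n. if digit n Cm i (Suc l) k then (1/2) ^ Suc l else 0)"
    unfolding sum.shift_bounds_Suc_ivl by (simp add: atLeast0LessThan)
  also have "\<dots> = (\<Sum>l\<in>net_digits n Cm k i. (1/2) ^ Suc l)"
    by (subst sum.inter_filter[symmetric]) (auto simp: net_digits_def)
  finally show ?thesis by (simp add: dyadic_mid_def)
qed

lemma tent_mid_net_digits_tendsto: "(\<lambda>L. tent_mid L (net_digits n Cm k)) \<longlonglongrightarrow> tent (net_point 2 n Cm k)"
proof (rule vec_tendstoI)
  fix i
  have "(\<lambda>L. (1/2::real) ^ Suc L) \<longlonglongrightarrow> 0" by (rule LIMSEQ_Suc[OF LIMSEQ_realpow_zero]) auto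
  then have "(\<lambda>L. \<bar>2 * (net_point 2 n Cm k $ i + (1/2) ^ Suc L) - 1\<bar>) \<longlonglongrightarrow> \<bar>2 * (net_point 2 n Cm k $ i + 0) - 1\<bar>"
    by (intro tendsto_intros)
  moreover have "\<forall>\<^sub>F L in sequentially. \<bar>2 * (net_point 2 n Cm k $ i + (1/2) ^ Suc L) - 1\<bar> = tent_mid L (net_digits n Cm k) $ i"
    using eventually_ge_at_top[of "2 * n"] by eventually_elim (simp add: tent_mid_nth dyadic_mid_net_digits)
  ultimately show "(\<lambda>L. tent_mid L (net_digits n Cm k) $ i) \<longlonglongrightarrow> tent (net_point 2 n Cm k) $ i"
    by (simp add: tent_def tendsto_cong)
qed

lemma grid_functional_tendsto:
  fixes f :: "real^'d::finite \<Rightarrow> real"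
  assumes f: "continuous_on unit_cube f"
  shows "(\<lambda>L. grid_functional n Cm L f) \<longlonglongrightarrow>
    (\<Sum>k<2 ^ n. f (tent (net_point 2 n Cm k))) / 2 ^ n - (LINT s|lebesgue_on unit_cube. f s)"
proof -
  have "(\<lambda>L. f (tent_mid L (net_digits n Cm k))) \<longlonglongrightarrow> f (tent (net_point 2 n Cm k))" for k
  proof -
    have in_cube: "\<forall>\<^sub>F L in sequentially. tent_mid L (net_digits n Cm k) \<in> unit_cube"
      using eventually_ge_at_top[of "Suc (2 * n)"]
    proof eventually_elim
      case (elim L)
      then have "tent_mid L (net_digits n Cm k) \<in> box 0 1"
        using tent_mid_in_box[of "net_digits n Cm k" "L - 1"] net_digits_in_digit_sets[of n L Cm k] by simp
      then show ?case using box_subset_cbox unfolding unit_cube_def by blast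
    qed
    have "tent (net_point 2 n Cm k) \<in> unit_cube"
      by (rule Lim_in_closed_set[OF _ in_cube _ tent_mid_net_digits_tendsto]) (auto simp: unit_cube_def)
    then show ?thesis
      by (rule continuous_on_tendsto_compose[OF f tent_mid_net_digits_tendsto _ in_cube])
  qed
  then have "(\<lambda>L. (\<Sum>k<2 ^ n. f (tent_mid L (net_digits n Cm k))) / 2 ^ n
        - (\<Sum>A\<in>digit_sets L. f (tent_mid L A)) / 2 ^ (L * CARD('d))) \<longlonglongrightarrow>
      (\<Sum>k<2 ^ n. f (tent (net_point 2 n Cm k))) / 2 ^ n - (LINT s|lebesgue_on unit_cube. f s)"
    by (intro tendsto_diff tendsto_divide tendsto_sum tendsto_const tent_mid_sum_tendsto f) auto
  moreover have "\<forall>\<^sub>F L in sequentially.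
      (\<Sum>k<2 ^ n. f (tent_mid L (net_digits n Cm k))) / 2 ^ n - (\<Sum>A\<in>digit_sets L. f (tent_mid L A)) / 2 ^ (L * CARD('d))
      = grid_functional n Cm L f"
    using eventually_ge_at_top[of "2 * n"] by eventually_elim (simp add: grid_functional_def sum_grid_weight)
  ultimately show ?thesis by (rule Lim_transform_eventually)
qed

lemma half_power_diff_le:
  "(1/2::real) ^ (2 * n - t) \<le> 2 ^ t * (2 ^ n) powr (-2)"
proof -
  have "(1/2::real) ^ (2 * n - t) = 2 ^ t * ((1/2) ^ t * (1/2) ^ (2 * n - t))"
    by (simp add: power_one_over)
  also have "\<dots> \<le> 2 ^ t * (1/2) ^ (2 * n)"
  proof (intro mult_left_mono)
    show "(1/2) ^ t * (1/2) ^ (2 * n - t) \<le> (1/2::real) ^ (2 * n)"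
      unfolding power_add[symmetric] by (intro power_decreasing) auto
  qed simp
  also have "(1/2::real) ^ (2 * n) = (2 ^ n) powr (-2)"
    by (simp add: powr_minus_divide power_one_over mult.commute flip: power_mult)
  finally show ?thesis .
qed

lemma rate_bound:
  assumes n: "n \<ge> 1"
  shows "(1/2) ^ (2 * n - t) * (real (2 * n - t) + 1) ^ q
     \<le> (3 / ln 2) ^ q * (2 ^ t * (2 ^ n) powr (-2) * ln (2 ^ n) ^ q)"
proof -
  have "real (2 * n - t) + 1 \<le> 3 * real n" using n by linarith
  also have "\<dots> = 3 / ln 2 * ln (2 ^ n)" by (simp add: ln_realpow)
  finally have "(real (2 * n - t) + 1) ^ q \<le> (3 / ln 2) ^ q * ln (2 ^ n) ^ q"
    by (simp only: power_mono power_mult_distrib[symmetric])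
  then have "(1/2) ^ (2 * n - t) * (real (2 * n - t) + 1) ^ q
      \<le> (2 ^ t * (2 ^ n) powr (-2)) * ((3 / ln 2) ^ q * ln (2 ^ n) ^ q)"
    using half_power_diff_le by (intro mult_mono) auto
  then show ?thesis by (simp only: mult_ac)
qed

definition qmc_const :: "nat \<Rightarrow> real" where
  "qmc_const d = (16 * peano_kernel_bound) ^ d * separated_const (2 * d - 1) * (3 / ln 2) ^ (2 * d - 1)"

lemma qmc_const_pos: "qmc_const d > 0"
  using peano_kernel_bound_ge_6 separated_const_pos by (simp add: qmc_const_def)

proposition qmc_error_le:
  fixes f :: "real^'d::finite \<Rightarrow> real"
  assumes net: "is_order_digital_net 2 t n Cm" and n: "n \<ge> 1" and f: "f \<in> H2mix_ball"
  shows "\<bar>(\<Sum>k<2 ^ n. f (tent (net_point 2 n Cm k))) / 2 ^ n - (LINT s|lebesgue_on unit_cube. f s)\<bar>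
     \<le> qmc_const CARD('d) * (2 ^ t * (2 ^ n) powr (-2) * ln (2 ^ n) ^ (2 * CARD('d) - 1))"
proof -
  define q M where "q = 2 * CARD('d) - 1" and "M = 2 * n - t"
  define B where "B = (8 * peano_kernel_bound) ^ CARD('d) * (separated_const q * ((1/2) ^ M * (real M + 1) ^ q))"
  have const: "(16 * peano_kernel_bound) ^ CARD('d) = 2 ^ CARD('d) * (8 * peano_kernel_bound) ^ CARD('d)"
    using power_mult_distrib[of 2 "8 * peano_kernel_bound" "CARD('d)"] by simp
  have "(\<lambda>L. \<bar>grid_functional n Cm L f\<bar>) \<longlonglongrightarrow>
      \<bar>(\<Sum>k<2 ^ n. f (tent (net_point 2 n Cm k))) / 2 ^ n - (LINT s|lebesgue_on unit_cube. f s)\<bar>"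
    using f by (intro tendsto_rabs grid_functional_tendsto) (simp add: H2mix_ball_def)
  moreover have "\<forall>\<^sub>F L in sequentially. \<bar>grid_functional n Cm L f\<bar> \<le> 2 ^ CARD('d) * B"
    using eventually_ge_at_top[of "Suc (2 * n)"]
  proof eventually_elim
    case (elim L)
    show ?case
      unfolding grid_functional_def
    proof (rule abs_H2mix_ball_functional_le[OF f finite_digit_sets])
      show "tent_mid L A \<in> box 0 1" if "A \<in> digit_sets L" for A
        using tent_mid_in_box[of A "L - 1"] that elim by simp
      show "\<bar>\<Sum>A\<in>digit_sets L. grid_weight n Cm L A * (\<Prod>i\<in>UNIV. h i (tent_mid L A $ i))\<bar> \<le> B"
        if "\<And>i. C1_convex peano_kernel_bound (h i)" for h
        using abs_grid_functional_prod_le[OF net _ that, of L] elim by (simp add: grid_functional_def B_def q_def M_def)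
    qed
  qed
  ultimately have "\<bar>(\<Sum>k<2 ^ n. f (tent (net_point 2 n Cm k))) / 2 ^ n - (LINT s|lebesgue_on unit_cube. f s)\<bar>
      \<le> 2 ^ CARD('d) * B"
    by (rule tendsto_upperbound) simp
  also have "2 ^ CARD('d) * B = (16 * peano_kernel_bound) ^ CARD('d) * separated_const q * ((1/2) ^ M * (real M + 1) ^ q)"
    by (simp only: B_def const mult.assoc)
  also have "\<dots> \<le> (16 * peano_kernel_bound) ^ CARD('d) * separated_const q
      * ((3 / ln 2) ^ q * (2 ^ t * (2 ^ n) powr (-2) * ln (2 ^ n) ^ q))"
    using peano_kernel_bound_ge_6 separated_const_pos[of q] rate_bound[OF n] unfolding M_def
    by (intro mult_left_mono) auto
  finally show ?thesis by (simp add: qmc_const_def q_def mult.assoc)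
qed

theorem theorem5p2:
  shows "\<exists>C>0. \<forall>(n::nat) (t::nat) (Cm :: 'd::finite \<Rightarrow> nat \<Rightarrow> nat \<Rightarrow> bool).
     n \<ge> 1 \<and> is_order_digital_net 2 t n Cm \<longrightarrow>
     qmc_wce (image_mset tent (digital_net 2 n Cm))
       \<le> ereal (C * 2 ^ t * (2 ^ n) powr (-2) * (ln (2 ^ n)) ^ (2 * CARD('d) - 1))"
proof (intro exI[of _ "qmc_const CARD('d)"] conjI allI impI qmc_const_pos)
  fix n t and Cm :: "'d \<Rightarrow> nat \<Rightarrow> nat \<Rightarrow> bool"
  assume net: "n \<ge> 1 \<and> is_order_digital_net 2 t n Cm"
  let ?X = "image_mset tent (digital_net 2 n Cm)"
  have average: "(\<Sum>x\<in>#?X. f x) / real (size ?X) = (\<Sum>k<2 ^ n. f (tent (net_point 2 n Cm k))) / 2 ^ n"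
    for f :: "real^'d \<Rightarrow> real"
    by (simp add: digital_net_def multiset.map_comp o_def flip: sum_unfold_sum_mset)
  show "qmc_wce ?X \<le> ereal (qmc_const CARD('d) * 2 ^ t * (2 ^ n) powr (-2) * (ln (2 ^ n)) ^ (2 * CARD('d) - 1))"
    unfolding qmc_wce_def average H2mix_ball_def[symmetric]
  proof (rule SUP_least)
    fix f :: "real^'d \<Rightarrow> real"
    assume "f \<in> H2mix_ball"
    then show "ereal \<bar>(\<Sum>k<2 ^ n. f (tent (net_point 2 n Cm k))) / 2 ^ n - (LINT x|lebesgue_on unit_cube. f x)\<bar>
      \<le> ereal (qmc_const CARD('d) * 2 ^ t * (2 ^ n) powr (-2) * (ln (2 ^ n)) ^ (2 * CARD('d) - 1))"
      using qmc_error_le[of t n Cm f] net by (simp add: mult.assoc)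
  qed
qed

end
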